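(* Let $d\in\mathbb{N}$, $s\in\mathbb{R}$, $0<p<\infty$, $0<q\le\infty$ and $\varphi\in\mathcal{G}_p$. Let $\delta$ be the Dirac distribution at the origin of $\mathbb{R}^d$. Then $$\delta\in\mathcal{N}^s_{\varphi,p,q}(\mathbb{R}^d)\qquad\text{if, and only if,}\qquad\left\{2^{j(s+d)}\varphi(2^{-j})\right\}_{j\in\mathbb{N}_0}\in\ell_q.$$
   Context: $\mathbb{N}_0=\mathbb{N}\cup\{0\}$. $\mathcal{G}_p$ is the set of all nondecreasing functions $\varphi:(0,\infty)\to(0,\infty)$ such that $t\mapsto \varphi(t)t^{-d/p}$ is nonincreasing. For $\varphi\in\mathcal{G}_p$, the generalised Morrey space $\mathcal{M}_{\varphi,p}(\mathbb{R}^d)$ is the set of all $f\in L_p^{\mathrm{loc}}(\mathbb{R}^d)$ with $$\|f\mid\mathcal{M}_{\varphi,p}(\mathbb{R}^d)\|:=\sup_{Q}\varphi(\ell(Q))\Big(\frac{1}{|Q|}\int_Q|f(y)|^p\,dy\Big)^{1/p}<\infty,$$ the supremum being over all dyadic cubes $Q=2^{-j}([0,1)^d+k)$, $j\in\mathbb{Z}$, $k\in\mathbb{Z}^d$, with side length $\ell(Q)$. Let $Q(r)$ be the compact cube centred at $0$ with side length $r$ and sides parallel to the axes. Let $\eta_0,\eta\in\mathcal{S}(\mathbb{R}^d)$ be nonnegative compactly supported functions with $\eta_0>0$ on $Q(2)$, $0\notin\operatorname{supp}\eta$ and $\eta>0$ on $Q(2)\setminus Q(1)$; put $\eta_j(x)=\eta(2^{-j}x)$,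 $j\in\mathbb{N}$. The generalised Besov-Morrey space $\mathcal{N}^s_{\varphi,p,q}(\mathbb{R}^d)$ is the set of all $f\in\mathcal{S}'(\mathbb{R}^d)$ with $$\|f\mid\mathcal{N}^s_{\varphi,p,q}(\mathbb{R}^d)\|:=\Big(\sum_{j=0}^\infty2^{jsq}\big\|\mathcal{F}^{-1}(\eta_j\mathcal{F}f)\mid\mathcal{M}_{\varphi,p}(\mathbb{R}^d)\big\|^q\Big)^{1/q}<\infty$$ (usual modification if $q=\infty$). Different choices of $\eta_0,\eta$ give equivalent quasi-norms. *)

theory Defs
  imports "HOL-Analysis.Analysis"
begin

section \<open>Schwartz functions and tempered distributions\<close>

definition partial_deriv :: "'n \<Rightarrow> (real^'n \<Rightarrow> 'b::real_normed_vector) \<Rightarrow> real^'n \<Rightarrow> 'b"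
  where "partial_deriv i f x = vector_derivative (\<lambda>t. f (x + t *\<^sub>R axis i 1)) (at 0)"

text \<open>Mixed derivatives are indexed by the list of directions in which one differentiates,
  so the list plays the role of a multi-index and its length that of the order.\<close>

definition partial_derivs ::
    "'n list \<Rightarrow> (real^'n \<Rightarrow> 'b::real_normed_vector) \<Rightarrow> real^'n \<Rightarrow> 'b"
  where "partial_derivs \<alpha> f = foldr partial_deriv \<alpha> f"

definition smooth :: "(real^'n::finite \<Rightarrow> 'b::real_normed_vector) \<Rightarrow> bool"
  where "smooth f \<longleftrightarrow> (\<forall>\<alpha> x. partial_derivs \<alpha> f differentiable (at x))"

definition schwartz :: "(real^'n::finite \<Rightarrow> 'b::real_normed_vector) set"
  where "schwartz = {f. smooth f \<and>
    (\<forall>N \<alpha>. bounded (range (\<lambda>x. (1 + norm x) ^ N *\<^sub>R partial_derivs \<alpha> f x)))}"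

definition schwartz_seminorm ::
    "nat \<Rightarrow> 'n list \<Rightarrow> (real^'n::finite \<Rightarrow> 'b::real_normed_vector) \<Rightarrow> real"
  where "schwartz_seminorm N \<alpha> f = (SUP x. (1 + norm x) ^ N * norm (partial_derivs \<alpha> f x))"

definition schwartz_topology :: "(real^'n::finite \<Rightarrow> 'b::real_normed_vector) topology"
  where "schwartz_topology = topology_generated_by
    {{g \<in> schwartz. schwartz_seminorm N \<alpha> (\<lambda>x. g x - f x) < r} | N \<alpha> f r. f \<in> schwartz \<and> 0 < r}"

text \<open>Functionals are total functions in HOL; only their values on Schwartz functions are
  meaningful.\<close>

type_synonym 'n functional = "(real^'n \<Rightarrow> complex) \<Rightarrow> complex"

definition tempered_distributions :: "'n::finite functional set"
  where "tempered_distributions = {T.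
    (\<forall>f\<in>schwartz. \<forall>g\<in>schwartz. \<forall>a b. T (\<lambda>x. a * f x + b * g x) = a * T f + b * T g) \<and>
    continuous_map schwartz_topology euclidean T}"

definition dirac :: "'n::finite functional"
  where "dirac \<psi> = \<psi> 0"

definition fourier :: "(real^'n::finite \<Rightarrow> complex) \<Rightarrow> real^'n \<Rightarrow> complex"
  where "fourier f \<xi> =
    complex_of_real ((2 * pi) powr (- real CARD('n) / 2)) *
      (LINT x|lebesgue. exp (- \<i> * complex_of_real (x \<bullet> \<xi>)) * f x)"

definition inv_fourier :: "(real^'n::finite \<Rightarrow> complex) \<Rightarrow> real^'n \<Rightarrow> complex"
  where "inv_fourier f x =
    complex_of_real ((2 * pi) powr (- real CARD('n) / 2)) *
      (LINT \<xi>|lebesgue. exp (\<i> * complex_of_real (x \<bullet> \<xi>)) * f \<xi>)"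

definition fourier_dist :: "'n::finite functional \<Rightarrow> 'n functional"
  where "fourier_dist T \<psi> = T (fourier \<psi>)"

definition inv_fourier_dist :: "'n::finite functional \<Rightarrow> 'n functional"
  where "inv_fourier_dist T \<psi> = T (inv_fourier \<psi>)"

definition mult_dist :: "(real^'n::finite \<Rightarrow> real) \<Rightarrow> 'n functional \<Rightarrow> 'n functional"
  where "mult_dist \<eta> T \<psi> = T (\<lambda>x. complex_of_real (\<eta> x) * \<psi> x)"

definition represents :: "(real^'n::finite \<Rightarrow> complex) \<Rightarrow> 'n functional \<Rightarrow> bool"
  where "represents g T \<longleftrightarrow> continuous_on UNIV g \<and>
    (\<forall>\<psi>\<in>schwartz. integrable lebesgue (\<lambda>x. g x * \<psi> x) \<and> T \<psi> = (LINT x|lebesgue. g x * \<psi> x))"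

text \<open>A continuous representing function is unique, and it exists for every tempered
  distribution whose Fourier transform has compact support (Paley--Wiener--Schwartz), which is
  the only case in which the following is used.\<close>

definition dist_function :: "'n::finite functional \<Rightarrow> real^'n \<Rightarrow> complex"
  where "dist_function T = (THE g. represents g T)"


section \<open>Generalised Morrey spaces\<close>

definition class_G :: "nat \<Rightarrow> real \<Rightarrow> (real \<Rightarrow> real) set"
  where "class_G d p = {\<phi>. (\<forall>t>0. 0 < \<phi> t) \<and>
    monotone_on {0<..} (\<le>) (\<le>) \<phi> \<and>
    monotone_on {0<..} (\<le>) (\<ge>) (\<lambda>t. \<phi> t * t powr (- real d / p))}"

text \<open>Used for positive exponents only.\<close>

definition ennpowr :: "ennreal \<Rightarrow> real \<Rightarrow> ennreal"
  where "ennpowr x a = (if x = \<infinity> then \<infinity> else ennreal (enn2real x powr a))"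

definition dyadic_cube :: "int \<Rightarrow> int^'n \<Rightarrow> (real^'n::finite) set"
  where "dyadic_cube j k =
    (\<lambda>x. (2 powi (- j)) *\<^sub>R (x + (\<chi> i. of_int (k $ i)))) ` {x. \<forall>i. 0 \<le> x $ i \<and> x $ i < 1}"

definition morrey_norm :: "(real \<Rightarrow> real) \<Rightarrow> real \<Rightarrow> (real^'n::finite \<Rightarrow> complex) \<Rightarrow> ennreal"
  where "morrey_norm \<phi> p f = (SUP (j, k) \<in> (UNIV :: (int \<times> (int^'n)) set).
    ennreal (\<phi> (2 powi (- j))) *
      ennpowr ((\<integral>\<^sup>+ y \<in> dyadic_cube j k. ennreal (norm (f y) powr p) \<partial>lebesgue)
                / emeasure lebesgue (dyadic_cube j k :: (real^'n) set)) (1 / p))"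

definition Lp_loc :: "real \<Rightarrow> (real^'n::finite \<Rightarrow> complex) set"
  where "Lp_loc p = {f \<in> borel_measurable lebesgue.
    \<forall>K. compact K \<longrightarrow> (\<integral>\<^sup>+ y \<in> K. ennreal (norm (f y) powr p) \<partial>lebesgue) < \<infinity>}"

definition morrey :: "(real \<Rightarrow> real) \<Rightarrow> real \<Rightarrow> (real^'n::finite \<Rightarrow> complex) set"
  where "morrey \<phi> p = {f \<in> Lp_loc p. morrey_norm \<phi> p f < \<infinity>}"


section \<open>Generalised Besov--Morrey spaces\<close>

definition lq_norm :: "ennreal \<Rightarrow> (nat \<Rightarrow> ennreal) \<Rightarrow> ennreal"
  where "lq_norm q a =
    (if q = \<infinity> then (SUP j. a j) else ennpowr (\<Sum>j. ennpowr (a j) (enn2real q)) (1 / enn2real q))"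

definition ell :: "ennreal \<Rightarrow> (nat \<Rightarrow> real) set"
  where "ell q = {a. lq_norm q (\<lambda>j. ennreal \<bar>a j\<bar>) < \<infinity>}"

definition cube :: "real \<Rightarrow> (real^'n::finite) set"
  where "cube r = cbox (\<chi> i. - r / 2) (\<chi> i. r / 2)"

definition supp :: "(real^'n::finite \<Rightarrow> real) \<Rightarrow> (real^'n) set"
  where "supp f = closure {x. f x \<noteq> 0}"

definition admissible :: "(real^'n::finite \<Rightarrow> real) \<Rightarrow> (real^'n \<Rightarrow> real) \<Rightarrow> bool"
  where "admissible \<eta>\<^sub>0 \<eta> \<longleftrightarrow>
    \<eta>\<^sub>0 \<in> schwartz \<and> \<eta> \<in> schwartz \<and>
    (\<forall>x. 0 \<le> \<eta>\<^sub>0 x) \<and> (\<forall>x. 0 \<le> \<eta> x) \<and>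
    compact (supp \<eta>\<^sub>0) \<and> compact (supp \<eta>) \<and>
    (\<forall>x\<in>cube 2. 0 < \<eta>\<^sub>0 x) \<and>
    0 \<notin> supp \<eta> \<and> (\<forall>x\<in>cube 2 - cube 1. 0 < \<eta> x)"

definition dyadic_dilate ::
    "(real^'n::finite \<Rightarrow> real) \<Rightarrow> (real^'n \<Rightarrow> real) \<Rightarrow> nat \<Rightarrow> real^'n \<Rightarrow> real"
  where "dyadic_dilate \<eta>\<^sub>0 \<eta> j = (if j = 0 then \<eta>\<^sub>0 else (\<lambda>x. \<eta> ((1 / 2 ^ j) *\<^sub>R x)))"

definition lp_piece ::
    "(real^'n::finite \<Rightarrow> real) \<Rightarrow> (real^'n \<Rightarrow> real) \<Rightarrow> nat \<Rightarrow> 'n functional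
      \<Rightarrow> real^'n \<Rightarrow> complex"
  where "lp_piece \<eta>\<^sub>0 \<eta> j T =
    dist_function (inv_fourier_dist (mult_dist (dyadic_dilate \<eta>\<^sub>0 \<eta> j) (fourier_dist T)))"

definition besov_morrey_norm ::
    "(real^'n::finite \<Rightarrow> real) \<Rightarrow> (real^'n \<Rightarrow> real) \<Rightarrow> real \<Rightarrow> (real \<Rightarrow> real) \<Rightarrow> real \<Rightarrow> ennreal
      \<Rightarrow> 'n functional \<Rightarrow> ennreal"
  where "besov_morrey_norm \<eta>\<^sub>0 \<eta> s \<phi> p q T =
    lq_norm q (\<lambda>j. ennreal (2 powr (real j * s)) * morrey_norm \<phi> p (lp_piece \<eta>\<^sub>0 \<eta> j T))"

definition besov_morrey ::
    "(real^'n::finite \<Rightarrow> real) \<Rightarrow> (real^'n \<Rightarrow> real) \<Rightarrow> real \<Rightarrow> (real \<Rightarrow> real) \<Rightarrow> real \<Rightarrow> ennreal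
      \<Rightarrow> 'n functional set"
  where "besov_morrey \<eta>\<^sub>0 \<eta> s \<phi> p q = {T \<in> tempered_distributions.
    (\<forall>j. lp_piece \<eta>\<^sub>0 \<eta> j T \<in> morrey \<phi> p) \<and> besov_morrey_norm \<eta>\<^sub>0 \<eta> s \<phi> p q T < \<infinity>}"

end

theory Submission
  imports Defs
begin

text \<open>The Fourier transform of the Dirac distribution is constant, so its Littlewood--Paley piece of
  index \<open>j\<close> is \<open>2\<^bsup>jd\<^esup> h(2\<^bsup>j\<^esup>x)\<close>, where \<open>h\<close> is a multiple of the inverse Fourier transform of \<open>\<eta>\<close> (of
  \<open>\<eta>\<^sub>0\<close> for \<open>j = 0\<close>). Since \<open>h\<close> is bounded, decays rapidly and \<open>h(0) \<noteq> 0\<close>, the two monotonicity properties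
  of \<open>\<phi>\<close> show that the Morrey norm of the piece is comparable to \<open>2\<^bsup>jd\<^esup> \<phi>(2\<^bsup>-j\<^esup>)\<close>: small cubes see only
  the supremum of \<open>h\<close>, large cubes only its \<open>L\<^sub>p\<close> norm, and the lower bound comes from a cube at the
  origin on which \<open>|h(2\<^bsup>j\<^esup>x)|\<close> stays above \<open>|h(0)| / 2\<close>.\<close>

text \<open>The pieces are given by a definite description, \<open>dist_function\<close>, so their
  formula needs a continuous representing function and its uniqueness. Existence comes from Fubini
  and the symmetry of the Fourier kernel. Uniqueness comes from testing a difference of two
  candidates against a rescaled bump that is concentrated where they disagree. Integrability of
  \<open>h\<close> would not be enough for the upper bound: when \<open>p\<close> is small,
  \<open>|h|\<close> to the power \<open>p\<close> is integrable only if \<open>h\<close> decays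
  fast. Hence decay of every order is derived, from the rule that the inverse transform turns
  partial derivatives into multiplication by coordinates. All constants have to be independent of
  \<open>j\<close>. This works because the pieces with \<open>j > 0\<close> are dilates of one
  profile, and the threshold between small and large cubes moves with the dilation. The piece with
  \<open>j = 0\<close> has a profile of its own, so two pairs of constants are merged at the end.
  The sequence norm enters only through its stability under termwise domination up to a constant,
  which treats all \<open>q\<close> alike.\<close>

section \<open>Schwartz functions\<close>

lemma partial_derivs_Nil [simp]: "partial_derivs [] f = f"
  by (simp add: partial_derivs_def)

lemma partial_derivs_Cons [simp]:
  "partial_derivs (i # \<alpha>) f = partial_deriv i (partial_derivs \<alpha> f)"
  by (simp add: partial_derivs_def)

lemma partial_derivs_snoc: "partial_derivs (\<alpha> @ [i]) f = partial_derivs \<alpha> (partial_deriv i f)"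
  by (simp add: partial_derivs_def)

text \<open>\<open>partial_deriv\<close> is a derivative at parameter 0. Moving the base point gives
  the derivative at every parameter of the line, as the mean value theorem requires.\<close>

lemma partial_deriv_has_vector_derivative:
  fixes f :: "real^'n::finite \<Rightarrow> 'b::real_normed_vector"
  assumes "\<And>x. f differentiable (at x)"
  shows "((\<lambda>t. f (x + t *\<^sub>R axis i 1)) has_vector_derivative partial_deriv i f (x + t *\<^sub>R axis i 1)) (at t)"
proof -
  have *: "((\<lambda>s. f (y + s *\<^sub>R axis i 1)) has_vector_derivative partial_deriv i f y) (at 0)" for y
  proof -
    have "(\<lambda>s. y + s *\<^sub>R axis i 1) differentiable at (0::real)"
      by (intro derivative_intros)
    moreover have "f differentiable at ((\<lambda>s. y + s *\<^sub>R axis i 1) (0::real))"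
      using assms by simp
    ultimately have "(\<lambda>s. f (y + s *\<^sub>R axis i 1)) differentiable at (0::real)"
      using differentiable_chain_at[of "\<lambda>s. y + s *\<^sub>R axis i 1" 0 f] by (simp add: o_def)
    then show ?thesis
      by (simp add: partial_deriv_def vector_derivative_works)
  qed
  have "((\<lambda>s. f ((x + t *\<^sub>R axis i 1) + (s - t) *\<^sub>R axis i 1)) has_vector_derivative
      1 *\<^sub>R partial_deriv i f (x + t *\<^sub>R axis i 1)) (at t)"
  proof -
    have "((\<lambda>s. s - t) has_real_derivative 1) (at t)"
      by (auto intro!: derivative_eq_intros)
    then show ?thesis
      using vector_diff_chain_at[of "\<lambda>s. s - t" 1 t "\<lambda>s. f ((x + t *\<^sub>R axis i 1) + s *\<^sub>R axis i 1)"]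
        *[of "x + t *\<^sub>R axis i 1"]
      by (simp add: o_def has_real_derivative_iff_has_vector_derivative)
  qed
  then show ?thesis
    by (simp add: algebra_simps)
qed

lemma partial_derivs_zero [simp]:
  "partial_derivs \<alpha> (\<lambda>x. 0) = (\<lambda>x::real^'n::finite. 0::'b::real_normed_vector)"
  by (induction \<alpha>) (auto simp: partial_deriv_def)

lemma partial_derivs_affine:
  fixes f :: "real^'n::finite \<Rightarrow> 'b::real_normed_vector"
  assumes "smooth f"
  shows "partial_derivs \<alpha> (\<lambda>x. f (c *\<^sub>R x + b)) =
    (\<lambda>x. c ^ length \<alpha> *\<^sub>R partial_derivs \<alpha> f (c *\<^sub>R x + b))"
proof (induction \<alpha>)
  case (Cons i \<alpha>)
  show ?case
  proof
    fix x
    let ?F = "partial_derivs \<alpha> f" and ?y = "c *\<^sub>R x + b"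
    have "((\<lambda>t. ?F (?y + t *\<^sub>R axis i 1)) has_vector_derivative partial_deriv i ?F ?y) (at 0)"
      using partial_deriv_has_vector_derivative[of ?F ?y i 0] assms by (simp add: smooth_def)
    moreover have "((\<lambda>t::real. c * t) has_real_derivative c) (at 0)"
      by (auto intro!: derivative_eq_intros)
    ultimately have "((\<lambda>t. ?F (?y + (c * t) *\<^sub>R axis i 1)) has_vector_derivative
        c *\<^sub>R partial_deriv i ?F ?y) (at 0)"
      using vector_diff_chain_at[of "\<lambda>t. c * t" c 0 "\<lambda>t. ?F (?y + t *\<^sub>R axis i 1)"]
      by (simp add: o_def has_real_derivative_iff_has_vector_derivative)
    then have "((\<lambda>t. c ^ length \<alpha> *\<^sub>R ?F (?y + (c * t) *\<^sub>R axis i 1)) has_vector_derivative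
        c ^ length \<alpha> *\<^sub>R c *\<^sub>R partial_deriv i ?F ?y) (at 0)"
      by (rule bounded_linear.has_vector_derivative[OF bounded_linear_scaleR_right])
    then have "vector_derivative (\<lambda>t. c ^ length \<alpha> *\<^sub>R ?F (c *\<^sub>R (x + t *\<^sub>R axis i 1) + b)) (at 0) =
        c ^ length (i # \<alpha>) *\<^sub>R partial_deriv i ?F ?y"
      by (intro vector_derivative_at) (simp add: algebra_simps)
    then show "partial_derivs (i # \<alpha>) (\<lambda>x. f (c *\<^sub>R x + b)) x =
        c ^ length (i # \<alpha>) *\<^sub>R partial_derivs (i # \<alpha>) f ?y"
      by (simp add: Cons.IH) (simp add: partial_deriv_def)
  qed
qed simp

lemma partial_derivs_of_real:
  fixes f :: "real^'n::finite \<Rightarrow> real"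
  assumes "smooth f"
  shows "partial_derivs \<alpha> (\<lambda>x. complex_of_real (f x)) = (\<lambda>x. complex_of_real (partial_derivs \<alpha> f x))"
proof (induction \<alpha>)
  case (Cons i \<alpha>)
  show ?case
  proof
    fix x
    let ?F = "partial_derivs \<alpha> f"
    have "((\<lambda>t. ?F (x + t *\<^sub>R axis i 1)) has_vector_derivative partial_deriv i ?F x) (at 0)"
      using partial_deriv_has_vector_derivative[of ?F x i 0] assms by (simp add: smooth_def)
    then have "((\<lambda>t. complex_of_real (?F (x + t *\<^sub>R axis i 1))) has_vector_derivative
        complex_of_real (partial_deriv i ?F x)) (at 0)"
      by (rule bounded_linear.has_vector_derivative[OF bounded_linear_of_real])
    then show "partial_derivs (i # \<alpha>) (\<lambda>x. complex_of_real (f x)) x =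
        complex_of_real (partial_derivs (i # \<alpha>) f x)"
      by (simp add: Cons.IH) (simp add: partial_deriv_def vector_derivative_at)
  qed
qed simp

lemma schwartz_iff:
  "f \<in> schwartz \<longleftrightarrow> smooth f \<and>
    (\<forall>N \<alpha>. \<exists>C. \<forall>x. (1 + norm x) ^ N * norm (partial_derivs \<alpha> f x) \<le> C)"
  by (simp add: schwartz_def bounded_iff)

lemma schwartz_smooth: "f \<in> schwartz \<Longrightarrow> smooth f"
  by (simp add: schwartz_def)

lemma schwartz_bound:
  assumes "f \<in> schwartz"
  obtains C where "0 < C" "\<And>x. norm (f x) \<le> C / (1 + norm x) ^ N"
proof -
  have "\<exists>C. \<forall>x. (1 + norm x) ^ N * norm (partial_derivs [] f x) \<le> C"
    using assms unfolding schwartz_iff by blast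
  then obtain C where C: "\<And>x. (1 + norm x) ^ N * norm (f x) \<le> C"
    unfolding partial_derivs_Nil by blast
  show thesis
  proof
    fix x
    have "norm (f x) * (1 + norm x) ^ N \<le> max C 1"
      using C[of x] by (simp add: mult.commute)
    then show "norm (f x) \<le> max C 1 / (1 + norm x) ^ N"
      by (subst pos_le_divide_eq) (auto intro!: zero_less_power add_pos_nonneg)
  qed simp
qed

lemma schwartz_differentiable: "f \<in> schwartz \<Longrightarrow> f differentiable (at x)"
proof -
  assume "f \<in> schwartz"
  then have "partial_derivs [] f differentiable (at x)"
    using schwartz_smooth smooth_def by blast
  then show ?thesis by simp
qed

lemma schwartz_continuous: "f \<in> schwartz \<Longrightarrow> continuous_on A f"
  by (intro continuous_at_imp_continuous_on ballI differentiable_imp_continuous_within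
      schwartz_differentiable)

lemma schwartz_borel_measurable:
  fixes f :: "real^'n::finite \<Rightarrow> 'b::real_normed_vector"
  shows "f \<in> schwartz \<Longrightarrow> f \<in> borel_measurable borel"
  by (intro borel_measurable_continuous_onI schwartz_continuous)

text \<open>The list of directions is folded from the right, so the derivatives of
  \<open>partial_deriv i f\<close> are those of \<open>f\<close> along lists ending in
  \<open>i\<close>. The conditions to check are among those known for \<open>f\<close>.\<close>

lemma schwartz_partial_deriv:
  assumes "f \<in> schwartz"
  shows "partial_deriv i f \<in> schwartz"
  using assms unfolding schwartz_def smooth_def mem_Collect_eq partial_derivs_snoc[symmetric]
  by blast

lemma schwartz_of_real:
  assumes "f \<in> schwartz"
  shows "(\<lambda>x. complex_of_real (f x)) \<in> schwartz"
proof -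
  have "(\<lambda>x. complex_of_real (partial_derivs \<alpha> f x)) differentiable at x" for \<alpha> x
  proof (rule differentiable_compose[of of_real "partial_derivs \<alpha> f"])
    show "complex_of_real differentiable (at (partial_derivs \<alpha> f x))"
      by (rule bounded_linear_imp_differentiable[OF bounded_linear_of_real])
    show "partial_derivs \<alpha> f differentiable (at x)"
      using schwartz_smooth[OF assms] by (simp add: smooth_def)
  qed
  then show ?thesis
    using assms unfolding schwartz_iff
    by (simp add: partial_derivs_of_real[OF schwartz_smooth[OF assms]] smooth_def)
qed

text \<open>Serves three purposes: the dilated cut-offs, the translates in difference quotients, and
  the bump shrunk around a point in the uniqueness proof.\<close>

lemma schwartz_affine:
  fixes f :: "real^'n::finite \<Rightarrow> 'b::real_normed_vector"
  assumes "f \<in> schwartz" "c \<noteq> 0"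
  shows "(\<lambda>x. f (c *\<^sub>R x + b)) \<in> schwartz"
proof -
  have sm: "smooth f"
    using assms by (simp add: schwartz_def)
  have "(\<lambda>x. partial_derivs \<alpha> f (c *\<^sub>R x + b)) differentiable at x" for \<alpha> x
  proof -
    have "(\<lambda>x. c *\<^sub>R x + b) differentiable at x"
      by (intro derivative_intros)
    moreover have "partial_derivs \<alpha> f differentiable at (c *\<^sub>R x + b)"
      using sm by (simp add: smooth_def)
    ultimately show ?thesis
      using differentiable_chain_at[of "\<lambda>x. c *\<^sub>R x + b" x "partial_derivs \<alpha> f"]
      by (simp add: o_def)
  qed
  then have "smooth (\<lambda>x. f (c *\<^sub>R x + b))"
    unfolding smooth_def partial_derivs_affine[OF sm]
    by (intro allI differentiable_scaleR[OF differentiable_const])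
  moreover have "\<exists>C. \<forall>x. (1 + norm x) ^ N * norm (c ^ length \<alpha> *\<^sub>R partial_derivs \<alpha> f (c *\<^sub>R x + b)) \<le> C" for N \<alpha>
  proof -
    obtain C where C: "\<And>x. (1 + norm x) ^ N * norm (partial_derivs \<alpha> f x) \<le> C"
      using assms(1) unfolding schwartz_iff by blast
    \<comment> \<open>From \<open>norm x \<le> (norm (c *\<^sub>R x + b) + norm b) /
      \<bar>c\<bar>\<close>: the three summands collect the constants, so that the weight at
      \<open>x\<close> is at most \<open>K\<close> times the weight at the image point.\<close>
    define K where "K = 1 + norm b / \<bar>c\<bar> + 1 / \<bar>c\<bar>"
    have K0: "0 \<le> K"
      unfolding K_def by (intro add_nonneg_nonneg divide_nonneg_nonneg) auto
    have K: "1 + norm x \<le> K * (1 + norm (c *\<^sub>R x + b))" for x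
    proof -
      let ?y = "norm (c *\<^sub>R x + b)"
      have "\<bar>c\<bar> * norm x \<le> ?y + norm b"
        using norm_triangle_ineq4[of "c *\<^sub>R x + b" b] by simp
      then have "norm x \<le> (?y + norm b) / \<bar>c\<bar>"
        using \<open>c \<noteq> 0\<close> by (subst pos_le_divide_eq) (auto simp: mult.commute)
      also have "\<dots> = 1 / \<bar>c\<bar> * ?y + norm b / \<bar>c\<bar>"
        by (simp add: add_divide_distrib)
      also have "\<dots> \<le> K * (1 + ?y) - 1"
        unfolding K_def using \<open>c \<noteq> 0\<close>
        by (simp add: distrib_left distrib_right del: divide_nonneg_nonneg)
      finally show ?thesis by simp
    qed
    have "(1 + norm x) ^ N * norm (c ^ length \<alpha> *\<^sub>R partial_derivs \<alpha> f (c *\<^sub>R x + b))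
        \<le> K ^ N * \<bar>c\<bar> ^ length \<alpha> * C" for x
    proof -
      have "(1 + norm x) ^ N * norm (c ^ length \<alpha> *\<^sub>R partial_derivs \<alpha> f (c *\<^sub>R x + b))
        \<le> (K * (1 + norm (c *\<^sub>R x + b))) ^ N * norm (c ^ length \<alpha> *\<^sub>R partial_derivs \<alpha> f (c *\<^sub>R x + b))"
        by (intro mult_right_mono power_mono K) auto
      also have "\<dots> = K ^ N * \<bar>c\<bar> ^ length \<alpha> * ((1 + norm (c *\<^sub>R x + b)) ^ N * norm (partial_derivs \<alpha> f (c *\<^sub>R x + b)))"
        by (simp only: power_mult_distrib power_abs norm_scaleR mult_ac)
      also have "\<dots> \<le> K ^ N * \<bar>c\<bar> ^ length \<alpha> * C"
        by (intro mult_left_mono C mult_nonneg_nonneg zero_le_power K0 abs_ge_zero)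
      finally show ?thesis .
    qed
    then show ?thesis by blast
  qed
  ultimately show ?thesis
    unfolding schwartz_iff partial_derivs_affine[OF sm] by blast
qed

section \<open>The Dirac distribution is tempered\<close>

lemma schwartz_seminorm_zero [simp]: "schwartz_seminorm N \<alpha> (\<lambda>x. 0) = 0"
  by (simp add: schwartz_seminorm_def)

lemma openin_schwartz_seminorm_ball:
  assumes "f \<in> schwartz" "0 < r"
  shows "openin schwartz_topology {g \<in> schwartz. schwartz_seminorm N \<alpha> (\<lambda>x. g x - f x) < r}"
  unfolding schwartz_topology_def using assms by (intro topology_generated_by_Basis) blast

lemma topspace_schwartz_topology:
  "topspace (schwartz_topology :: (real^'n::finite \<Rightarrow> 'b::real_normed_vector) topology) = schwartz"
proof
  show "topspace (schwartz_topology :: (real^'n \<Rightarrow> 'b) topology) \<subseteq> schwartz"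
    unfolding schwartz_topology_def topology_generated_by_topspace by blast
  show "schwartz \<subseteq> topspace (schwartz_topology :: (real^'n \<Rightarrow> 'b) topology)"
  proof
    fix f :: "real^'n \<Rightarrow> 'b"
    assume f: "f \<in> schwartz"
    then have "f \<in> {g \<in> schwartz. schwartz_seminorm 0 [] (\<lambda>x. g x - f x) < 1}"
      by simp
    then show "f \<in> topspace schwartz_topology"
      using openin_subset[OF openin_schwartz_seminorm_ball[OF f zero_less_one]] by blast
  qed
qed

text \<open>Evaluation at 0 is dominated by the supremum norm, which is the seminorm of order 0 with
  weight exponent 0. Each preimage of an open set therefore contains a seminorm ball around each of
  its points.\<close>

lemma dirac_tempered: "(dirac :: 'n::finite functional) \<in> tempered_distributions"
proof -
  have "openin schwartz_topology {f \<in> schwartz. (dirac :: 'n functional) f \<in> U}" if U: "open U" for U :: "complex set"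
  proof (subst openin_subopen, safe)
    fix f :: "real^'n \<Rightarrow> complex"
    assume f: "f \<in> schwartz" "dirac f \<in> U"
    then obtain r where r: "r > 0" "ball (f 0) r \<subseteq> U"
      using U by (auto simp: dirac_def open_contains_ball)
    let ?V = "{g \<in> schwartz. schwartz_seminorm 0 [] (\<lambda>x. g x - f x) < r}"
    have "openin schwartz_topology ?V"
      using f r by (intro openin_schwartz_seminorm_ball)
    moreover have "f \<in> ?V"
      using f r by simp
    moreover have "dirac g \<in> U" if g: "g \<in> ?V" for g
    proof -
      \<comment> \<open>A real supremum bounds its members only if the set is bounded above; the
        bounds on \<open>f\<close> and \<open>g\<close> secure this for
        \<open>g - f\<close>.\<close>
      obtain A where A: "\<And>x. norm (f x) \<le> A / (1 + norm x) ^ 0"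
        using schwartz_bound[of f 0] f by blast
      obtain B where B: "\<And>x. norm (g x) \<le> B / (1 + norm x) ^ 0"
        using schwartz_bound[of g 0] g by blast
      have "norm (g x - f x) \<le> B + A" for x
        using A[of x] B[of x] norm_triangle_ineq4[of "g x" "f x"] by simp
      then have "norm (g 0 - f 0) \<le> (SUP x. norm (g x - f x))"
        by (intro cSUP_upper bdd_aboveI2) auto
      then have "norm (g 0 - f 0) < r"
        using g by (simp add: schwartz_seminorm_def)
      then have "g 0 \<in> ball (f 0) r"
        by (simp add: dist_norm norm_minus_commute)
      then show ?thesis
        using r by (auto simp: dirac_def)
    qed
    ultimately show "\<exists>T. openin schwartz_topology T \<and> f \<in> T \<and> T \<subseteq> {f \<in> schwartz. dirac f \<in> U}"
      by blast
  qed
  then have "continuous_map schwartz_topology euclidean (dirac :: 'n functional)"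
    by (auto simp: continuous_map topspace_schwartz_topology)
  then show ?thesis
    by (simp add: tempered_distributions_def dirac_def)
qed

section \<open>Integration on Euclidean space\<close>

text \<open>Put \<open>x\<close> in the shell where \<open>norm x\<close> lies between
  \<open>k\<close> and \<open>k + 1\<close>. There the integrand is at most
  \<open>(k+1)^-(d+2)\<close>, and the shell lies in a ball of volume proportional to
  \<open>(k+1)^d\<close>. The exponent \<open>d + 2\<close> is chosen so that the series of inverse
  squares remains.\<close>

lemma nn_integral_inverse_power_finite:
  "(\<integral>\<^sup>+ x. ennreal (1 / (1 + norm (x::'a::euclidean_space)) ^ (DIM('a) + 2)) \<partial>lborel) < \<infinity>"
proof -
  let ?d = "DIM('a)" and ?V = "unit_ball_vol (DIM('a))"
  let ?a = "\<lambda>k x. ennreal (1 / real (Suc k) ^ (?d + 2)) * indicator (ball 0 (real (Suc k))) (x::'a)"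
  have le: "ennreal (1 / (1 + norm x) ^ (?d + 2)) \<le> (\<Sum>k. ?a k x)" for x :: 'a
  proof -
    define k where "k = nat \<lfloor>norm x\<rfloor>"
    have k: "real k \<le> norm x" "norm x < real (Suc k)"
      unfolding k_def by auto linarith
    have "1 / (1 + norm x) ^ (?d + 2) \<le> 1 / real (Suc k) ^ (?d + 2)"
      using k by (intro frac_le power_mono zero_less_power) auto
    then have "ennreal (1 / (1 + norm x) ^ (?d + 2)) \<le> ?a k x"
      using k by (simp add: ennreal_leI del: power_Suc power_add_numeral2)
    also have "\<dots> = (\<Sum>k\<in>{k}. ?a k x)"
      by (simp only: sum.insert finite.emptyI empty_iff not_False_eq_True sum.empty add_0_right)
    also have "\<dots> \<le> (\<Sum>k. ?a k x)"
      by (intro sum_le_suminf) auto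
    finally show ?thesis .
  qed
  have a: "(\<integral>\<^sup>+ x. ?a k x \<partial>lborel) = ennreal (?V * inverse (real (Suc k) ^ 2))" for k
  proof -
    have "(\<integral>\<^sup>+ x. ?a k x \<partial>lborel) = ennreal (1 / real (Suc k) ^ (?d + 2) * (?V * real (Suc k) ^ ?d))"
    proof (subst nn_integral_cmult_indicator)
      have "emeasure lborel (ball (0::'a) (real (Suc k))) = ennreal (?V * real (Suc k) ^ ?d)"
        by (rule emeasure_ball) simp
      then show "ennreal (1 / real (Suc k) ^ (?d + 2)) * emeasure lborel (ball (0::'a) (real (Suc k))) =
          ennreal (1 / real (Suc k) ^ (?d + 2) * (?V * real (Suc k) ^ ?d))"
        by (simp only:) (intro ennreal_mult[symmetric] mult_nonneg_nonneg; simp)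
    qed simp
    also have "1 / real (Suc k) ^ (?d + 2) * (?V * real (Suc k) ^ ?d) = ?V * inverse (real (Suc k) ^ 2)"
      unfolding power_add by (simp add: divide_inverse del: of_nat_Suc)
    finally show ?thesis .
  qed
  have "(\<integral>\<^sup>+ x. (\<Sum>k. ?a k x) \<partial>lborel) = (\<Sum>k. \<integral>\<^sup>+ x. ?a k x \<partial>lborel)"
    by (rule nn_integral_suminf) (intro borel_measurable_times_ennreal borel_measurable_indicator; simp)
  also have "\<dots> = (\<Sum>k. ennreal (?V * inverse (real (Suc k) ^ 2)))"
    by (simp only: a)
  also have "\<dots> = ennreal (\<Sum>k. ?V * inverse (real (Suc k) ^ 2))"
    using inverse_power_summable[of 2, where 'a=real]
      summable_Suc_iff[of "\<lambda>n. inverse (real n ^ 2)"]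
    by (intro suminf_ennreal2 summable_mult) auto
  finally have "(\<integral>\<^sup>+ x. (\<Sum>k. ?a k x) \<partial>lborel) < \<infinity>"
    by simp
  then show ?thesis
    using nn_integral_mono[of lborel "\<lambda>x. ennreal (1 / (1 + norm x) ^ (?d + 2))" "\<lambda>x. \<Sum>k. ?a k x"] le
    by (meson order.strict_trans1)
qed

lemma integrable_decay:
  fixes f :: "'a::euclidean_space \<Rightarrow> 'b::{banach, second_countable_topology}"
  assumes "f \<in> borel_measurable borel"
    and "\<And>x. norm (f x) \<le> C / (1 + norm x) ^ (DIM('a) + 2)"
  shows "integrable lborel f"
proof (rule Bochner_Integration.integrable_bound)
  have "integrable lborel (\<lambda>x::'a. 1 / (1 + norm x) ^ (DIM('a) + 2))"
    using nn_integral_inverse_power_finite[where 'a='a] by (intro integrableI_bounded) auto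
  then show "integrable lborel (\<lambda>x::'a. C * (1 / (1 + norm x) ^ (DIM('a) + 2)))"
    by (rule integrable_mult_right)
  show "AE x in lborel. norm (f x) \<le> norm (C * (1 / (1 + norm x) ^ (DIM('a) + 2)))"
  proof (rule AE_I2)
    fix x
    show "norm (f x) \<le> norm (C * (1 / (1 + norm x) ^ (DIM('a) + 2)))"
      using order_trans[OF assms(2) abs_ge_self, of x] by (simp only: real_norm_def mult_1_right times_divide_eq_right)
  qed
qed (use assms in auto)

lemma integrable_schwartz:
  fixes f :: "real^'n::finite \<Rightarrow> 'b::{banach, second_countable_topology}"
  assumes "f \<in> schwartz"
  shows "integrable lborel f"
proof -
  obtain C where "\<And>x. norm (f x) \<le> C / (1 + norm x) ^ (CARD('n) + 2)"
    using schwartz_bound[OF assms] by metis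
  then show ?thesis
    using schwartz_borel_measurable[OF assms] by (intro integrable_decay) auto
qed

lemma lborel_integral_affine:
  fixes f :: "'a::euclidean_space \<Rightarrow> 'b::{banach, second_countable_topology}"
  assumes [measurable]: "f \<in> borel_measurable borel" and "c \<noteq> 0"
  shows "(LINT x|lborel. f x) = \<bar>c\<bar> ^ DIM('a) *\<^sub>R (LINT x|lborel. f (t + c *\<^sub>R x))"
  by (subst lborel_affine[OF \<open>c \<noteq> 0\<close>, of t])
    (simp add: integral_density integral_distr)

lemma nn_integral_lborel_scale:
  fixes f :: "'a::euclidean_space \<Rightarrow> ennreal"
  assumes [measurable]: "f \<in> borel_measurable borel" and "c \<noteq> 0"
  shows "(\<integral>\<^sup>+x. f x \<partial>lborel) = ennreal (\<bar>c\<bar> ^ DIM('a)) * (\<integral>\<^sup>+x. f (c *\<^sub>R x) \<partial>lborel)"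
  by (subst lborel_affine[OF \<open>c \<noteq> 0\<close>, of 0])
    (simp add: nn_integral_density nn_integral_distr nn_integral_cmult)

text \<open>Dominated convergence works along sequences, so the derivative is taken along the steps
  \<open>1 / (n + 1)\<close>.\<close>

lemma has_vector_derivative_imp_LIMSEQ:
  assumes "(g has_vector_derivative D) (at 0)"
  shows "(\<lambda>n. real (Suc n) *\<^sub>R (g (inverse (real (Suc n))) - g 0)) \<longlonglongrightarrow> D"
proof -
  have "((\<lambda>h. norm (g (0 + h) - g 0 - h *\<^sub>R D) / norm h) \<longlongrightarrow> 0) (at 0)"
    using assms by (simp only: has_vector_derivative_def has_derivative_at)
  moreover have "filterlim (\<lambda>n. inverse (real (Suc n))) (at 0) sequentially"
    by (intro filterlim_atI LIMSEQ_inverse_real_of_nat) auto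
  ultimately have "(\<lambda>n. norm (g (0 + inverse (real (Suc n))) - g 0 - inverse (real (Suc n)) *\<^sub>R D) /
      norm (inverse (real (Suc n)))) \<longlonglongrightarrow> 0"
    by (rule filterlim_compose)
  moreover have "norm (g (0 + inverse (real (Suc n))) - g 0 - inverse (real (Suc n)) *\<^sub>R D) /
      norm (inverse (real (Suc n))) = norm (real (Suc n) *\<^sub>R (g (inverse (real (Suc n))) - g 0) - D)" for n
  proof -
    have "norm (g (0 + inverse (real (Suc n))) - g 0 - inverse (real (Suc n)) *\<^sub>R D) /
        norm (inverse (real (Suc n))) =
      norm (real (Suc n) *\<^sub>R (g (inverse (real (Suc n))) - g 0 - inverse (real (Suc n)) *\<^sub>R D))"
      unfolding norm_scaleR norm_inverse add_0 by (simp add: divide_inverse mult.commute)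
    also have "\<dots> = norm (real (Suc n) *\<^sub>R (g (inverse (real (Suc n))) - g 0) - D)"
      by (simp add: scaleR_diff_right del: of_nat_Suc)
    finally show ?thesis .
  qed
  ultimately show ?thesis
    by (simp add: tendsto_norm_zero_iff LIM_zero_iff del: of_nat_Suc)
qed

section \<open>The inverse Fourier transform\<close>

lemma fourier_kernel_measurable [measurable]:
  "(\<lambda>\<xi>. exp (\<i> * complex_of_real (x \<bullet> \<xi>))) \<in> borel_measurable (borel :: (real^'n::finite) measure)"
  by (intro borel_measurable_continuous_onI continuous_intros)

lemma inv_fourier_lborel:
  fixes f :: "real^'n::finite \<Rightarrow> complex"
  assumes [measurable]: "f \<in> borel_measurable borel"
  shows "inv_fourier f x = complex_of_real ((2 * pi) powr (- real CARD('n) / 2)) *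
    (LINT \<xi>|lborel. exp (\<i> * complex_of_real (x \<bullet> \<xi>)) * f \<xi>)"
  unfolding inv_fourier_def by (subst integral_completion) auto

lemma norm_fourier_kernel_mult [simp]: "norm (exp (\<i> * complex_of_real t) * z) = norm z"
  by (simp add: norm_mult)

lemma integrable_fourier_kernel:
  fixes f :: "real^'n::finite \<Rightarrow> complex"
  assumes "integrable lborel f"
  shows "integrable lborel (\<lambda>\<xi>. exp (\<i> * complex_of_real (x \<bullet> \<xi>)) * f \<xi>)"
  using assms by (rule Bochner_Integration.integrable_bound) (use assms in auto)

lemma norm_inv_fourier_le:
  fixes f :: "real^'n::finite \<Rightarrow> complex"
  assumes "integrable lborel f"
  shows "norm (inv_fourier f x) \<le> (2 * pi) powr (- real CARD('n) / 2) * (LINT \<xi>|lborel. norm (f \<xi>))"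
proof -
  have [measurable]: "f \<in> borel_measurable borel"
    using borel_measurable_integrable[OF assms] by simp
  have "norm (LINT \<xi>|lborel. exp (\<i> * complex_of_real (x \<bullet> \<xi>)) * f \<xi>) \<le> (LINT \<xi>|lborel. norm (f \<xi>))"
    using integral_norm_bound[of lborel "\<lambda>\<xi>. exp (\<i> * complex_of_real (x \<bullet> \<xi>)) * f \<xi>"] by simp
  then show ?thesis
    by (simp add: inv_fourier_lborel norm_mult mult_left_mono)
qed

lemma continuous_on_inv_fourier:
  fixes f :: "real^'n::finite \<Rightarrow> complex"
  assumes "integrable lborel f"
  shows "continuous_on UNIV (inv_fourier f)"
proof -
  have [measurable]: "f \<in> borel_measurable borel"
    using borel_measurable_integrable[OF assms] by simp
  have "isCont (inv_fourier f) x" for x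
  proof (rule continuous_at_sequentiallyI)
    fix u :: "nat \<Rightarrow> real^'n"
    assume "u \<longlonglongrightarrow> x"
    then have "(\<lambda>n. LINT \<xi>|lborel. exp (\<i> * complex_of_real (u n \<bullet> \<xi>)) * f \<xi>) \<longlonglongrightarrow>
        (LINT \<xi>|lborel. exp (\<i> * complex_of_real (x \<bullet> \<xi>)) * f \<xi>)"
      by (intro integral_dominated_convergence[where w="\<lambda>\<xi>. norm (f \<xi>)"] integrable_norm assms)
        (auto intro!: AE_I2 tendsto_intros)
    then show "(\<lambda>n. inv_fourier f (u n)) \<longlonglongrightarrow> inv_fourier f x"
      by (simp add: inv_fourier_lborel tendsto_mult_left)
  qed
  then show ?thesis
    by (simp add: continuous_on_eq_continuous_at)
qed

lemma inv_fourier_dilate: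
  fixes f :: "real^'n::finite \<Rightarrow> complex"
  assumes [measurable]: "f \<in> borel_measurable borel" and "c > 0"
  shows "inv_fourier (\<lambda>\<xi>. f ((1 / c) *\<^sub>R \<xi>)) x = complex_of_real (c ^ CARD('n)) * inv_fourier f (c *\<^sub>R x)"
proof -
  have "(LINT \<xi>|lborel. exp (\<i> * complex_of_real (x \<bullet> \<xi>)) * f ((1 / c) *\<^sub>R \<xi>)) =
      c ^ CARD('n) *\<^sub>R (LINT \<xi>|lborel. exp (\<i> * complex_of_real (x \<bullet> (0 + c *\<^sub>R \<xi>))) * f ((1 / c) *\<^sub>R (0 + c *\<^sub>R \<xi>)))"
    using \<open>c > 0\<close>
    by (subst lborel_integral_affine[where c=c and t=0]) auto
  then show ?thesis
    using \<open>c > 0\<close> by (simp add: inv_fourier_lborel scaleR_conv_of_real[where 'a=complex])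
qed

text \<open>Supplies the integrable majorant for difference quotients, uniformly in the step. The
  mean value inequality leads to a point at distance at most 1 from \<open>x\<close>; such a shift
  changes \<open>1 + norm x\<close> by a factor of at most 2, whence \<open>2 ^ N\<close>.\<close>

lemma norm_difference_quotient_le:
  fixes f :: "real^'n::finite \<Rightarrow> complex"
  assumes f: "f \<in> schwartz"
    and C: "\<And>x. norm (partial_deriv i f x) \<le> C / (1 + norm x) ^ N"
    and t: "0 < t" "t \<le> 1"
  shows "norm (f (x + t *\<^sub>R axis i 1) - f x) \<le> t * (2 ^ N * C / (1 + norm x) ^ N)"
proof -
  have D: "((\<lambda>t. f (x + t *\<^sub>R axis i 1)) has_vector_derivative partial_deriv i f (x + t *\<^sub>R axis i 1)) (at t)" for t
    by (intro partial_deriv_has_vector_derivative schwartz_differentiable f)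
  have "\<exists>y\<in>{0<..<t}. norm (f (x + t *\<^sub>R axis i 1) - f (x + 0 *\<^sub>R axis i 1)) \<le>
      norm ((t - 0) *\<^sub>R partial_deriv i f (x + y *\<^sub>R axis i 1))"
    using t D
    by (intro mvt_general) (auto simp: has_vector_derivative_def
        intro!: continuous_at_imp_continuous_on has_vector_derivative_continuous)
  then obtain y where y: "0 < y" "y < t"
    and le: "norm (f (x + t *\<^sub>R axis i 1) - f x) \<le> t * norm (partial_deriv i f (x + y *\<^sub>R axis i 1))"
    using t by auto
  have "norm x \<le> norm (x + y *\<^sub>R axis i 1) + norm (y *\<^sub>R axis i 1 :: real^'n)"
    using norm_triangle_ineq4[of "x + y *\<^sub>R axis i 1" "y *\<^sub>R axis i 1"] by simp
  then have "(1 + norm x) ^ N \<le> (2 * (1 + norm (x + y *\<^sub>R axis i 1))) ^ N"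
    using y t norm_ge_zero[of "x + y *\<^sub>R axis i 1"] norm_ge_zero[of x]
    by (intro power_mono) (simp_all add: norm_axis_1 del: norm_ge_zero)
  moreover have "0 \<le> C"
    using order_trans[OF norm_ge_zero C[of 0]] by simp
  ultimately have "C * (1 + norm x) ^ N \<le> C * (2 ^ N * (1 + norm (x + y *\<^sub>R axis i 1)) ^ N)"
    unfolding power_mult_distrib by (intro mult_left_mono)
  moreover have "0 < (1 + norm x) ^ N" "0 < (1 + norm (x + y *\<^sub>R axis i 1)) ^ N"
    by (auto intro!: zero_less_power add_pos_nonneg)
  ultimately have "C / (1 + norm (x + y *\<^sub>R axis i 1)) ^ N \<le> 2 ^ N * C / (1 + norm x) ^ N"
    by (simp add: divide_simps mult_ac)
  with C[of "x + y *\<^sub>R axis i 1"] have "norm (partial_deriv i f (x + y *\<^sub>R axis i 1)) \<le> 2 ^ N * C / (1 + norm x) ^ N"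
    by linarith
  with le t show ?thesis
    by (meson mult_left_mono order.trans less_imp_le)
qed

lemma integral_fourier_kernel_translate:
  fixes f :: "real^'n::finite \<Rightarrow> complex"
  assumes [measurable]: "f \<in> borel_measurable borel"
  shows "(LINT \<xi>|lborel. exp (\<i> * complex_of_real (x \<bullet> \<xi>)) * f (\<xi> + a)) =
    exp (- \<i> * complex_of_real (x \<bullet> a)) * (LINT \<xi>|lborel. exp (\<i> * complex_of_real (x \<bullet> \<xi>)) * f \<xi>)"
proof -
  have "(LINT \<xi>|lborel. exp (\<i> * complex_of_real (x \<bullet> \<xi>)) * f (\<xi> + a)) =
      (LINT \<xi>|lborel. exp (\<i> * complex_of_real (x \<bullet> (- a + 1 *\<^sub>R \<xi>))) * f ((- a + 1 *\<^sub>R \<xi>) + a))"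
    by (subst lborel_integral_affine[where c=1 and t="- a"]) auto
  also have "\<dots> = (LINT \<xi>|lborel. exp (- \<i> * complex_of_real (x \<bullet> a)) * (exp (\<i> * complex_of_real (x \<bullet> \<xi>)) * f \<xi>))"
    by (intro Bochner_Integration.integral_cong refl)
      (simp add: inner_diff_right right_diff_distrib exp_diff exp_minus field_simps)
  finally show ?thesis
    by simp
qed

text \<open>No integration by parts is needed: the transform of a difference quotient is computed by
  translation invariance, and its limit by dominated convergence.\<close>

lemma inv_fourier_partial_deriv:
  fixes f :: "real^'n::finite \<Rightarrow> complex"
  assumes f: "f \<in> schwartz"
  shows "inv_fourier (partial_deriv i f) x = - \<i> * complex_of_real (x $ i) * inv_fourier f x"
proof -
  note pf = schwartz_partial_deriv[OF f, of i]
  note [measurable] = schwartz_borel_measurable[OF f] schwartz_borel_measurable[OF pf]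
  let ?N = "CARD('n) + 2"
  obtain C where C: "\<And>x. norm (partial_deriv i f x) \<le> C / (1 + norm x) ^ ?N"
    using schwartz_bound[OF pf] by metis
  let ?e = "\<lambda>\<xi>. exp (\<i> * complex_of_real (x \<bullet> \<xi>))"
  let ?I = "LINT \<xi>|lborel. ?e \<xi> * f \<xi>"
  \<comment> \<open>The steps lie in \<open>(0, 1]\<close>, so the uniform bound on difference
    quotients applies, and multiplying by \<open>Suc n\<close> cancels them exactly.\<close>
  define t where "t n = inverse (real (Suc n))" for n
  have t: "0 < t n" "t n \<le> 1" "real (Suc n) * t n = 1" for n
    by (auto simp: t_def inverse_le_1_iff simp del: of_nat_Suc)
  let ?s = "\<lambda>n \<xi>. ?e \<xi> * (real (Suc n) *\<^sub>R (f (\<xi> + t n *\<^sub>R axis i 1) - f \<xi>))"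
  have "(\<lambda>n. LINT \<xi>|lborel. ?s n \<xi>) \<longlonglongrightarrow> (LINT \<xi>|lborel. ?e \<xi> * partial_deriv i f \<xi>)"
  proof (rule integral_dominated_convergence)
    show "integrable lborel (\<lambda>\<xi>::real^'n. 2 ^ ?N * C / (1 + norm \<xi>) ^ ?N)"
    proof (rule integrable_decay)
      show "norm (2 ^ ?N * C / (1 + norm \<xi>) ^ ?N) \<le> \<bar>2 ^ ?N * C\<bar> / (1 + norm \<xi>) ^ (DIM(real^'n) + 2)" for \<xi> :: "real^'n"
        by (simp add: abs_mult)
    qed measurable
    show "AE \<xi> in lborel. (\<lambda>n. ?s n \<xi>) \<longlonglongrightarrow> ?e \<xi> * partial_deriv i f \<xi>"
    proof (intro AE_I2 tendsto_mult_left)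
      fix \<xi> :: "real^'n"
      have "((\<lambda>t. f (\<xi> + t *\<^sub>R axis i 1)) has_vector_derivative partial_deriv i f (\<xi> + 0 *\<^sub>R axis i 1)) (at 0)"
        by (intro partial_deriv_has_vector_derivative schwartz_differentiable f)
      from has_vector_derivative_imp_LIMSEQ[OF this]
      show "(\<lambda>n. real (Suc n) *\<^sub>R (f (\<xi> + t n *\<^sub>R axis i 1) - f \<xi>)) \<longlonglongrightarrow> partial_deriv i f \<xi>"
        by (simp add: t_def)
    qed
    show "AE \<xi> in lborel. norm (?s n \<xi>) \<le> 2 ^ ?N * C / (1 + norm \<xi>) ^ ?N" for n
    proof (rule AE_I2)
      fix \<xi> :: "real^'n"
      have "norm (?s n \<xi>) = real (Suc n) * norm (f (\<xi> + t n *\<^sub>R axis i 1) - f \<xi>)"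
        by simp
      also have "\<dots> \<le> real (Suc n) * (t n * (2 ^ ?N * C / (1 + norm \<xi>) ^ ?N))"
        by (intro mult_left_mono norm_difference_quotient_le f C t) auto
      also have "\<dots> = 2 ^ ?N * C / (1 + norm \<xi>) ^ ?N"
        unfolding mult.assoc[symmetric] t by simp
      finally show "norm (?s n \<xi>) \<le> 2 ^ ?N * C / (1 + norm \<xi>) ^ ?N" .
    qed
  qed measurable
  \<comment> \<open>The same integrals in closed form: translating \<open>f\<close> multiplies its
    transform by a phase, so the difference quotient passes from \<open>f\<close> to the
    phase.\<close>
  moreover have "(LINT \<xi>|lborel. ?s n \<xi>) =
      real (Suc n) *\<^sub>R (exp (- \<i> * complex_of_real (x $ i) * complex_of_real (t n)) - 1) * ?I" for n
  proof -
    have int: "integrable lborel (\<lambda>\<xi>. ?e \<xi> * f \<xi>)"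
      by (intro integrable_fourier_kernel integrable_schwartz f)
    have "integrable lborel (\<lambda>\<xi>. ?e \<xi> * f (\<xi> + t n *\<^sub>R axis i 1))"
      using schwartz_affine[OF f, of 1 "t n *\<^sub>R axis i 1"]
      by (intro integrable_fourier_kernel integrable_schwartz) simp
    then have "(LINT \<xi>|lborel. real (Suc n) *\<^sub>R (?e \<xi> * f (\<xi> + t n *\<^sub>R axis i 1) - ?e \<xi> * f \<xi>)) =
        real (Suc n) *\<^sub>R (exp (- \<i> * complex_of_real (x \<bullet> (t n *\<^sub>R axis i 1))) * ?I - ?I)"
      using int by (simp add: integral_fourier_kernel_translate del: of_nat_Suc)
    then show ?thesis
      by (simp add: algebra_simps inner_axis del: of_nat_Suc)
  qed
  ultimately have "(\<lambda>n. real (Suc n) *\<^sub>R (exp (- \<i> * complex_of_real (x $ i) * complex_of_real (t n)) - 1) * ?I)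
      \<longlonglongrightarrow> (LINT \<xi>|lborel. ?e \<xi> * partial_deriv i f \<xi>)"
    by simp
  \<comment> \<open>As a function of the step, the phase has derivative
    \<open>- \<i> * x $ i\<close> at 0; this is the second value of the limit.\<close>
  moreover have "((\<lambda>t::real. exp (- \<i> * complex_of_real (x $ i) * complex_of_real t)) has_vector_derivative
      - \<i> * complex_of_real (x $ i)) (at 0)"
    by (auto intro!: derivative_eq_intros has_vector_derivative_real_field)
  from tendsto_mult_right[OF has_vector_derivative_imp_LIMSEQ[OF this], of ?I]
  have "(\<lambda>n. real (Suc n) *\<^sub>R (exp (- \<i> * complex_of_real (x $ i) * complex_of_real (t n)) - 1) * ?I)
      \<longlonglongrightarrow> - \<i> * complex_of_real (x $ i) * ?I"
    by (simp add: t_def)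
  ultimately have "(LINT \<xi>|lborel. ?e \<xi> * partial_deriv i f \<xi>) = - \<i> * complex_of_real (x $ i) * ?I"
    by (rule LIMSEQ_unique)
  then show ?thesis
    by (simp add: inv_fourier_lborel)
qed

text \<open>The two claims share one induction, since the rule for a single derivative applies to an
  iterate only once that iterate is known to be a Schwartz function.\<close>

lemma inv_fourier_iterated_partial_deriv:
  fixes f :: "real^'n::finite \<Rightarrow> complex"
  assumes f: "f \<in> schwartz"
  shows "(partial_deriv i ^^ N) f \<in> schwartz \<and>
    inv_fourier ((partial_deriv i ^^ N) f) x = (- \<i> * complex_of_real (x $ i)) ^ N * inv_fourier f x"
  by (induction N) (auto simp: f schwartz_partial_deriv inv_fourier_partial_deriv)

text \<open>Derivatives control \<open>\<bar>x $ i\<bar> ^ N\<close> for single coordinates; a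
  dominant coordinate turns this into control of \<open>norm x ^ N\<close>.\<close>

lemma norm_le_card_mult_component:
  obtains i where "norm x \<le> real CARD('n) * \<bar>(x :: real^'n::finite) $ i\<bar>"
proof (rule ccontr)
  assume "\<not> thesis"
  with that have "\<bar>x $ i\<bar> < norm x / real CARD('n)" for i
    by (metis not_le pos_divide_le_eq zero_less_card_finite of_nat_0_less_iff mult.commute)
  then have "(\<Sum>i\<in>UNIV. \<bar>x $ i\<bar>) < (\<Sum>i\<in>(UNIV :: 'n set). norm x / real CARD('n))"
    by (intro sum_strict_mono) auto
  then show False
    using norm_le_l1_cart[of x] by simp
qed

lemma inv_fourier_decay:
  fixes f :: "real^'n::finite \<Rightarrow> complex"
  assumes f: "f \<in> schwartz"
  obtains C where "0 < C" "\<And>x. norm (inv_fourier f x) \<le> C / (1 + norm x) ^ N"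
proof -
  define B where "B g = (2 * pi) powr (- real CARD('n) / 2) * (LINT \<xi>|lborel. norm (g \<xi> :: complex))"
    for g :: "real^'n \<Rightarrow> complex"
  \<comment> \<open>The dominant coordinate varies with the point, so the bounds for all coordinates
    are added. The summand \<open>B f\<close> accounts for the 1 in \<open>1 + ?a ^ N\<close>
    below.\<close>
  define D where "D = B f + real CARD('n) ^ N * (\<Sum>i\<in>UNIV. B ((partial_deriv i ^^ N) f))"
  have B0: "0 \<le> B g" for g
    by (simp add: B_def)
  have B: "norm (inv_fourier g x) \<le> B g" if "g \<in> schwartz" for g x
    unfolding B_def by (intro norm_inv_fourier_le integrable_schwartz that)
  have le: "norm (inv_fourier f x) * (1 + norm x) ^ N \<le> 2 ^ N * D" for x
  proof -
    obtain i where i: "norm x \<le> real CARD('n) * \<bar>x $ i\<bar>"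
      by (rule norm_le_card_mult_component)
    let ?a = "real CARD('n) * \<bar>x $ i\<bar>" and ?F = "norm (inv_fourier f x)"
    have "\<bar>x $ i\<bar> ^ N * ?F = norm (inv_fourier ((partial_deriv i ^^ N) f) x)"
      using inv_fourier_iterated_partial_deriv[OF f, where i=i and N=N and x=x]
      by (simp add: norm_mult norm_power)
    also have "\<dots> \<le> B ((partial_deriv i ^^ N) f)"
      using inv_fourier_iterated_partial_deriv[OF f, where i=i and N=N and x=x] by (intro B) simp
    also have "\<dots> \<le> (\<Sum>i\<in>UNIV. B ((partial_deriv i ^^ N) f))"
      by (intro member_le_sum B0) auto
    finally have sum: "\<bar>x $ i\<bar> ^ N * ?F \<le> (\<Sum>i\<in>UNIV. B ((partial_deriv i ^^ N) f))" .
    have "(1 + norm x) ^ N \<le> (2 * max 1 ?a) ^ N"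
      using i by (intro power_mono) auto
    also have "\<dots> \<le> 2 ^ N * (1 + ?a ^ N)"
      by (auto simp: power_mult_distrib max_def)
    finally have "?F * (1 + norm x) ^ N \<le> ?F * (2 ^ N * (1 + ?a ^ N))"
      by (rule mult_left_mono) simp
    also have "\<dots> = 2 ^ N * (?F + real CARD('n) ^ N * (\<bar>x $ i\<bar> ^ N * ?F))"
      by (simp add: algebra_simps power_mult_distrib)
    also have "\<dots> \<le> 2 ^ N * D"
      unfolding D_def using sum B[OF f, of x] by (intro mult_left_mono add_mono) auto
    finally show ?thesis .
  qed
  show thesis
  proof
    show "0 < 2 ^ N * D + 1"
      unfolding D_def by (intro add_nonneg_pos mult_nonneg_nonneg add_nonneg_nonneg sum_nonneg B0) auto
    show "norm (inv_fourier f x) \<le> (2 ^ N * D + 1) / (1 + norm x) ^ N" for x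
      using le[of x] by (subst pos_le_divide_eq) (auto intro!: zero_less_power add_pos_nonneg)
  qed
qed

text \<open>The order of decay is chosen after \<open>p\<close>: with
  \<open>N * p \<ge> d + 2\<close> the power is dominated by the integrable function treated above.
  This is why decay of every order is assumed.\<close>

lemma nn_integral_norm_powr_finite:
  fixes h :: "'a::euclidean_space \<Rightarrow> 'b::real_normed_vector"
  assumes "0 < p" and decay: "\<And>N. \<exists>C>0. \<forall>x. norm (h x) \<le> C / (1 + norm x) ^ N"
  shows "(\<integral>\<^sup>+ x. ennreal (norm (h x) powr p) \<partial>lborel) < \<infinity>"
proof -
  let ?d = "DIM('a) + 2"
  obtain N :: nat where "real ?d / p \<le> real N"
    using real_arch_simple by blast
  then have N: "real ?d \<le> real N * p"
    using \<open>0 < p\<close> by (simp add: pos_divide_le_eq)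
  obtain C where C: "0 < C" "\<And>x. norm (h x) \<le> C / (1 + norm x) ^ N"
    using decay by blast
  have le: "norm (h x) powr p \<le> C powr p * (1 / (1 + norm x) ^ ?d)" for x
  proof -
    have pos: "0 < 1 + norm x"
      by (simp add: add_pos_nonneg)
    have "norm (h x) powr p \<le> (C / (1 + norm x) ^ N) powr p"
      using C(2) \<open>0 < p\<close> by (intro powr_mono2) auto
    also have "\<dots> = C powr p / (1 + norm x) powr (real N * p)"
      using C(1) pos by (simp add: powr_divide powr_powr flip: powr_realpow)
    also have "\<dots> \<le> C powr p / (1 + norm x) powr real ?d"
      using N C(1) pos by (intro divide_left_mono powr_mono mult_pos_pos) auto
    also have "\<dots> = C powr p * (1 / (1 + norm x) ^ ?d)"
      using pos by (subst powr_realpow) auto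
    finally show ?thesis .
  qed
  have "(\<integral>\<^sup>+ x. ennreal (norm (h x) powr p) \<partial>lborel) \<le>
      (\<integral>\<^sup>+ x. ennreal (C powr p) * ennreal (1 / (1 + norm (x::'a)) ^ ?d) \<partial>lborel)"
    using le C(1) by (intro nn_integral_mono) (simp add: ennreal_leI flip: ennreal_mult)
  also have "\<dots> = ennreal (C powr p) * (\<integral>\<^sup>+ x. ennreal (1 / (1 + norm (x::'a)) ^ ?d) \<partial>lborel)"
    by (rule nn_integral_cmult) measurable
  also have "\<dots> < \<infinity>"
    using nn_integral_inverse_power_finite[where 'a='a] by (simp add: ennreal_mult_less_top)
  finally show ?thesis .
qed

section \<open>Uniqueness and existence of the continuous representing function\<close>

lemma integral_continuous_pos:
  fixes f :: "'a::euclidean_space \<Rightarrow> real"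
  assumes cont: "continuous_on UNIV f" and int: "integrable lborel f"
    and nonneg: "\<And>x. 0 \<le> f x" and pos: "0 < f a"
  shows "0 < (LINT x|lborel. f x)"
proof -
  have "isCont f a"
    using cont by (simp add: continuous_on_eq_continuous_at)
  then obtain r where r: "0 < r" "\<And>x. dist x a < r \<Longrightarrow> dist (f x) (f a) < f a / 2"
    using pos unfolding continuous_at_eps_delta by (metis half_gt_zero)
  \<comment> \<open>The integral is at least \<open>f a / 2\<close> times the volume of a ball on
    which \<open>f\<close> stays close to \<open>f a\<close>.\<close>
  have "f a / 2 * indicator (ball a r) x \<le> f x" for x
    using r(2)[of x] nonneg[of x] by (auto simp: indicator_def dist_real_def dist_commute abs_real_def split: if_splits)
  moreover have "integrable lborel (\<lambda>x. f a / 2 * indicator (ball a r) x)"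
    by (intro integrable_mult_right integrable_real_indicator) (use emeasure_bounded_finite[OF bounded_ball[of a r]] in auto)
  ultimately have "(LINT x|lborel. f a / 2 * indicator (ball a r) x) \<le> (LINT x|lborel. f x)"
    by (intro integral_mono int) auto
  moreover have "0 < (LINT x|lborel. f a / 2 * indicator (ball a r) x)"
    using pos content_ball_pos[OF r(1), of a] by simp
  ultimately show ?thesis
    by simp
qed

text \<open>Continuity of \<open>g\<close> makes the integrands Borel measurable, and then the
  completed measure can be replaced by \<open>lborel\<close>. Without continuity both sides are
  false, hence the case distinction.\<close>

lemma represents_lborel:
  "represents g T \<longleftrightarrow> continuous_on UNIV g \<and>
    (\<forall>\<psi>\<in>schwartz. integrable lborel (\<lambda>x. g x * \<psi> x) \<and> T \<psi> = (LINT x|lborel. g x * \<psi> x))"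
proof (cases "continuous_on UNIV g")
  case True
  then have "(\<lambda>x. g x * \<psi> x) \<in> borel_measurable lborel" if "\<psi> \<in> schwartz" for \<psi>
    using continuous_on_mult[OF _ schwartz_continuous[OF that]]
    by (simp add: borel_measurable_continuous_onI)
  then show ?thesis
    by (simp add: represents_def integrable_completion integral_completion cong: ball_cong)
qed (simp add: represents_def)

text \<open>The bump \<open>b\<close>, shrunk around a point where \<open>g\<close> and \<open>h\<close> differ, separates them; \<open>\<eta>\<^sub>0\<close> will
  play this role, so no bump function has to be constructed.\<close>

lemma represents_unique:
  fixes b :: "real^'n::finite \<Rightarrow> real"
  assumes b: "b \<in> schwartz" "\<And>x. 0 \<le> b x" "0 < b 0" "bounded {x. b x \<noteq> 0}"
    and g: "represents g (T :: 'n functional)" and h: "represents h T"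
  shows "g = h"
proof (rule ccontr)
  assume "g \<noteq> h"
  then obtain a where a: "g a \<noteq> h a"
    by blast
  define u where "u x = g x - h x" for x
  have "isCont u a"
    using g h unfolding u_def represents_def
    by (auto simp: continuous_on_eq_continuous_at intro!: continuous_intros)
  moreover have ua: "0 < norm (u a) / 2"
    using a by (simp add: u_def)
  ultimately obtain r where r: "0 < r" "\<And>x. dist x a < r \<Longrightarrow> dist (u x) (u a) < norm (u a) / 2"
    unfolding continuous_at_eps_delta by metis
  obtain R where R: "0 < R" "\<And>x. b x \<noteq> 0 \<Longrightarrow> norm x \<le> R"
    using b(4) unfolding bounded_pos by blast
  \<comment> \<open>The rescaled bump lives within distance \<open>R / c = r / 2\<close> of
    \<open>a\<close>, strictly inside the ball on which \<open>u\<close> is close to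
    \<open>u a\<close>.\<close>
  define c where "c = 2 * R / r"
  have c: "0 < c"
    using r R by (simp add: c_def)
  define w where "w x = b (c *\<^sub>R x + (- c *\<^sub>R a))" for x
  have w: "w \<in> schwartz"
    unfolding w_def using b(1) c by (intro schwartz_affine) auto
  have w0: "0 \<le> w x" for x
    by (simp add: w_def b(2))
  have supp: "norm (u x - u a) \<le> norm (u a) / 2" if "w x \<noteq> 0" for x
  proof -
    have "norm (c *\<^sub>R (x - a)) \<le> R"
      using that R(2) unfolding w_def by (simp add: scaleR_diff_right)
    then have "dist x a \<le> R / c"
      using c by (simp add: dist_norm pos_le_divide_eq mult.commute)
    also have "\<dots> < r"
      using r R by (simp add: c_def)
    finally show ?thesis
      using r(2)[of x] by (simp add: dist_norm)
  qed
  have iw: "integrable lborel w"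
    by (intro integrable_schwartz w)
  have cw: "(\<lambda>x. complex_of_real (w x)) \<in> schwartz"
    by (intro schwartz_of_real w)
  have ug: "integrable lborel (\<lambda>x. u x * w x)" "(LINT x|lborel. u x * w x) = 0"
    using g h cw unfolding represents_lborel u_def by (auto simp: left_diff_distrib)
  have icw: "integrable lborel (\<lambda>x. u a * w x)"
    by (intro integrable_mult_right integrable_schwartz cw)
  let ?I = "LINT x|lborel. w x"
  have "0 < ?I"
    by (rule integral_continuous_pos[of _ a]) (auto simp: w0 iw intro: schwartz_continuous w, simp add: w_def b(3))
  \<comment> \<open>The integral of \<open>u * w\<close> vanishes, so replacing \<open>u a\<close>
    by \<open>u a - u x\<close> costs nothing. On the support of \<open>w\<close> that difference is
    at most half of \<open>norm (u a)\<close>, which contradicts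
    \<open>u a \<noteq> 0\<close>.\<close>
  have "norm (u a) * ?I = norm (LINT x|lborel. u a * w x)"
    using \<open>0 < ?I\<close> by (simp add: norm_mult)
  also have "\<dots> = norm (LINT x|lborel. (u x - u a) * w x)"
    using ug icw by (simp add: left_diff_distrib norm_minus_commute)
  also have "\<dots> \<le> (LINT x|lborel. norm (u a) / 2 * w x)"
  proof (rule Bochner_Integration.integral_norm_bound_integral)
    show "integrable lborel (\<lambda>x. (u x - u a) * complex_of_real (w x))"
      using ug icw by (simp add: left_diff_distrib)
    show "norm ((u x - u a) * complex_of_real (w x)) \<le> norm (u a) / 2 * w x" for x
      using supp[of x] w0[of x] by (cases "w x = 0") (auto simp: norm_mult intro!: mult_right_mono)
  qed (use iw in auto)
  also have "\<dots> = norm (u a) / 2 * ?I"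
    by simp
  finally show False
    using mult_pos_pos[OF \<open>0 < ?I\<close> ua] by (simp add: mult.commute)
qed

text \<open>The inverse transform moves from one factor of the pairing to the other by Fubini,
  because its kernel is symmetric in the two variables. The kernel has modulus 1, so the double
  integral converges absolutely as a product of two finite integrals.\<close>

lemma represents_inv_fourier:
  fixes f :: "real^'n::finite \<Rightarrow> complex"
  assumes f: "f \<in> schwartz"
  shows "represents (inv_fourier f) (\<lambda>\<psi>. LINT \<xi>|lborel. f \<xi> * inv_fourier \<psi> \<xi>)"
  unfolding represents_lborel
proof (intro conjI ballI)
  have intf: "integrable lborel f"
    by (intro integrable_schwartz f)
  note [measurable] = schwartz_borel_measurable[OF f]
  show cont: "continuous_on UNIV (inv_fourier f)"
    by (intro continuous_on_inv_fourier intf)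
  then have [measurable]: "inv_fourier f \<in> borel_measurable borel"
    by (rule borel_measurable_continuous_onI)
  fix \<psi> :: "real^'n \<Rightarrow> complex"
  assume psi: "\<psi> \<in> schwartz"
  note [measurable] = schwartz_borel_measurable[OF psi]
  have intp: "integrable lborel \<psi>"
    by (intro integrable_schwartz psi)
  define c where "c = complex_of_real ((2 * pi) powr (- real CARD('n) / 2))"
  let ?B = "(2 * pi) powr (- real CARD('n) / 2) * (LINT \<xi>|lborel. norm (f \<xi>))"
  show "integrable lborel (\<lambda>x. inv_fourier f x * \<psi> x)"
  proof (rule Bochner_Integration.integrable_bound)
    show "integrable lborel (\<lambda>x. ?B * norm (\<psi> x))"
      using intp by (intro integrable_mult_right integrable_norm)
    show "AE x in lborel. norm (inv_fourier f x * \<psi> x) \<le> norm (?B * norm (\<psi> x))"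
      using norm_inv_fourier_le[OF intf]
      by (auto simp: norm_mult abs_mult intro!: AE_I2 mult_right_mono)
  qed measurable
  have [measurable]: "(\<lambda>z. exp (\<i> * complex_of_real (fst z \<bullet> snd z)))
      \<in> borel_measurable ((borel :: (real^'n) measure) \<Otimes>\<^sub>M (borel :: (real^'n) measure))"
    unfolding borel_prod by (intro borel_measurable_continuous_onI continuous_intros)
  have int: "integrable (lborel \<Otimes>\<^sub>M lborel) (\<lambda>(x, \<xi>). exp (\<i> * complex_of_real (x \<bullet> \<xi>)) * (f \<xi> * \<psi> x))"
  proof (rule lborel_pair.Fubini_integrable)
    show "integrable lborel (\<lambda>x. LINT \<xi>|lborel. norm (case (x, \<xi>) of (x, \<xi>) \<Rightarrow> exp (\<i> * complex_of_real (x \<bullet> \<xi>)) * (f \<xi> * \<psi> x)))"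
      using intp by (simp add: norm_mult)
    show "AE x in lborel. integrable lborel (\<lambda>\<xi>. case (x, \<xi>) of (x, \<xi>) \<Rightarrow> exp (\<i> * complex_of_real (x \<bullet> \<xi>)) * (f \<xi> * \<psi> x))"
      using intf by (auto intro!: AE_I2 integrable_fourier_kernel)
  qed (simp add: case_prod_beta)
  have inner: "(LINT \<xi>|lborel. exp (\<i> * complex_of_real (x \<bullet> \<xi>)) * (f \<xi> * \<psi> x)) =
      (LINT \<xi>|lborel. exp (\<i> * complex_of_real (x \<bullet> \<xi>)) * f \<xi>) * \<psi> x" for x
    unfolding integral_mult_left_zero[symmetric] by (simp add: mult_ac)
  have "(LINT x|lborel. exp (\<i> * complex_of_real (x \<bullet> \<xi>)) * (f \<xi> * \<psi> x)) =
      f \<xi> * (LINT x|lborel. exp (\<i> * complex_of_real (\<xi> \<bullet> x)) * \<psi> x)" for \<xi>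
    unfolding integral_mult_right_zero[symmetric] by (simp add: inner_commute mult_ac)
  then have "(LINT \<xi>|lborel. f \<xi> * inv_fourier \<psi> \<xi>) =
      c * (LINT \<xi>|lborel. LINT x|lborel. exp (\<i> * complex_of_real (x \<bullet> \<xi>)) * (f \<xi> * \<psi> x))"
    by (simp add: inv_fourier_lborel c_def mult.left_commute[of "f _"])
  also have "\<dots> = c * (LINT x|lborel. LINT \<xi>|lborel. exp (\<i> * complex_of_real (x \<bullet> \<xi>)) * (f \<xi> * \<psi> x))"
    by (subst lborel_pair.Fubini_integral[OF int]) (rule refl)
  also have "\<dots> = (LINT x|lborel. inv_fourier f x * \<psi> x)"
    unfolding inner by (simp add: inv_fourier_lborel c_def mult.assoc)
  finally show "(LINT \<xi>|lborel. f \<xi> * inv_fourier \<psi> \<xi>) = (LINT x|lborel. inv_fourier f x * \<psi> x)" .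
qed

section \<open>Morrey norms of dilates\<close>

lemma ennpowr_ennreal: "0 \<le> x \<Longrightarrow> ennpowr (ennreal x) a = ennreal (x powr a)"
  by (simp add: ennpowr_def)

lemma ennpowr_mono:
  assumes "x \<le> y" "0 \<le> a"
  shows "ennpowr x a \<le> ennpowr y a"
proof (cases "y = \<infinity>")
  case False
  then have "enn2real x powr a \<le> enn2real y powr a"
    using assms by (intro powr_mono2 enn2real_mono) (auto simp: less_top)
  then show ?thesis
    using False assms by (auto simp: ennpowr_def ennreal_leI top_unique)
qed (simp add: ennpowr_def)

lemma ennpowr_less_top_iff: "ennpowr x a < top \<longleftrightarrow> x < top"
  by (simp add: ennpowr_def less_top)

lemma ennpowr_cmult:
  assumes "0 < c"
  shows "ennpowr (ennreal c * x) a = ennreal (c powr a) * ennpowr x a"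
proof (cases "x = \<infinity>")
  case True
  then show ?thesis
    using assms by (simp add: ennpowr_def ennreal_mult_top)
next
  case False
  then show ?thesis
    using assms by (simp add: ennpowr_def enn2real_mult powr_mult ennreal_mult_eq_top_iff flip: ennreal_mult)
qed

text \<open>Finiteness alone is transferred: for finite \<open>q\<close> the outer root does not
  affect it, and the constant leaves the series as \<open>c powr q\<close>.\<close>

lemma lq_norm_finite_cmult_le:
  assumes le: "\<And>j. a j \<le> ennreal c * b j" and "0 < c" and b: "lq_norm q b < \<infinity>"
  shows "lq_norm q a < \<infinity>"
proof (cases "q = \<infinity>")
  case True
  have "(SUP j. a j) \<le> ennreal c * (SUP j. b j)"
    by (intro SUP_least order_trans[OF le] mult_left_mono SUP_upper) auto
  also have "\<dots> < \<infinity>"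
    using b True by (simp add: lq_norm_def ennreal_mult_less_top)
  finally show ?thesis
    using True by (simp add: lq_norm_def)
next
  case False
  define r where "r = enn2real q"
  have r: "0 \<le> r"
    by (simp add: r_def)
  have "(\<Sum>j. ennpowr (a j) r) \<le> (\<Sum>j. ennreal (c powr r) * ennpowr (b j) r)"
    using ennpowr_mono[OF le r] by (intro suminf_le) (auto simp: ennpowr_cmult[OF \<open>0 < c\<close>])
  also have "\<dots> = ennreal (c powr r) * (\<Sum>j. ennpowr (b j) r)"
    by simp
  also have "\<dots> < \<infinity>"
    using b False by (simp add: lq_norm_def ennpowr_less_top_iff ennreal_mult_less_top flip: r_def)
  finally show ?thesis
    using False by (simp add: lq_norm_def ennpowr_less_top_iff flip: r_def)
qed

section \<open>Measurability and volume of dyadic cubes\<close>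

lemma dyadic_cube_eq:
  "(dyadic_cube j k :: (real^'n::finite) set) =
    {x. \<forall>i. 2 powi (- j) * of_int (k $ i) \<le> x $ i \<and> x $ i < 2 powi (- j) * of_int (k $ i) + 2 powi (- j)}"
  (is "_ = ?R")
proof (intro set_eqI iffI)
  let ?l = "2 powi (- j) :: real"
  have l: "0 < ?l"
    by simp
  fix x :: "real^'n"
  show "x \<in> ?R" if "x \<in> dyadic_cube j k"
    using that l by (auto simp: dyadic_cube_def algebra_simps simp del: power_int_minus)
  show "x \<in> dyadic_cube j k" if x: "x \<in> ?R"
  proof -
    define y :: "real^'n" where "y = (\<chi> i. x $ i / ?l - of_int (k $ i))"
    have "0 \<le> y $ i \<and> y $ i < 1" for i
    proof -
      have "of_int (k $ i) * ?l \<le> x $ i" "x $ i < (of_int (k $ i) + 1) * ?l"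
        using x by (auto simp: distrib_right mult.commute simp del: power_int_minus)
      then have "of_int (k $ i) \<le> x $ i / ?l" "x $ i / ?l < of_int (k $ i) + 1"
        using pos_le_divide_eq[OF l] pos_divide_less_eq[OF l] by blast+
      then show ?thesis
        unfolding y_def by simp
    qed
    moreover have "x = ?l *\<^sub>R (y + (\<chi> i. of_int (k $ i)))"
      using l by (simp add: y_def vec_eq_iff del: power_int_minus)
    ultimately show ?thesis
      unfolding dyadic_cube_def by blast
  qed
qed

lemma borel_dyadic_cube [measurable]: "(dyadic_cube j k :: (real^'n::finite) set) \<in> sets borel"
  unfolding dyadic_cube_eq by measurable

text \<open>The half-open cube is squeezed between the open and the closed box with the same
  corners, which have equal volume.\<close>

lemma emeasure_dyadic_cube:
  "emeasure lborel (dyadic_cube j k :: (real^'n::finite) set) = ennreal ((2 powi (- j)) ^ CARD('n))"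
proof -
  let ?l = "2 powi (- j) :: real"
  let ?a = "(\<chi> i. ?l * of_int (k $ i)) :: real^'n" and ?e = "(\<chi> i. ?l) :: real^'n"
  have l: "0 < ?l"
    by simp
  have prod: "(\<Prod>b\<in>Basis. (?a + ?e - ?a) \<bullet> b) = ?l ^ CARD('n)"
  proof -
    have "(?a + ?e - ?a) \<bullet> b = ?l" if "b \<in> Basis" for b
      using that by (auto simp: Basis_vec_def inner_axis simp del: power_int_minus)
    then show ?thesis
      by (simp del: power_int_minus)
  qed
  have ab: "?a \<bullet> b \<le> (?a + ?e) \<bullet> b" if "b \<in> Basis" for b
    using that l by (auto simp: Basis_vec_def inner_axis simp del: power_int_minus)
  have "box ?a (?a + ?e) \<subseteq> dyadic_cube j k" "dyadic_cube j k \<subseteq> cbox ?a (?a + ?e)"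
    unfolding dyadic_cube_eq by (auto simp: mem_box_cart less_imp_le simp del: power_int_minus)
  then have "emeasure lborel (box ?a (?a + ?e)) \<le> emeasure lborel (dyadic_cube j k)"
    and "emeasure lborel (dyadic_cube j k) \<le> emeasure lborel (cbox ?a (?a + ?e))"
    by (auto intro!: emeasure_mono simp del: power_int_minus)
  moreover have "emeasure lborel (box ?a (?a + ?e)) = ennreal (?l ^ CARD('n))"
    using emeasure_lborel_box[OF ab] unfolding prod by blast
  moreover have "emeasure lborel (cbox ?a (?a + ?e)) = ennreal (?l ^ CARD('n))"
    using emeasure_lborel_cbox[OF ab] unfolding prod by blast
  ultimately show ?thesis
    by (intro antisym) auto
qed

lemma class_G_scale_le:
  assumes phi: "\<phi> \<in> class_G d p" and l: "0 < s" "s \<le> t"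
  shows "\<phi> t * t powr (- real d / p) \<le> \<phi> s * s powr (- real d / p)"
  using phi l unfolding class_G_def by (auto simp: monotone_on_def)

lemma class_G_mono:
  assumes phi: "\<phi> \<in> class_G d p" and l: "0 < s" "s \<le> t"
  shows "\<phi> s \<le> \<phi> t"
  using phi l unfolding class_G_def by (auto simp: monotone_on_def)

lemma class_G_pos: "\<phi> \<in> class_G d p \<Longrightarrow> 0 < t \<Longrightarrow> 0 < \<phi> t"
  unfolding class_G_def by auto

text \<open>Cubes of side length at most \<open>1 / R\<close> are controlled by the supremum of \<open>h\<close> and the monotonicity
  of \<open>\<phi>\<close>, larger ones by the \<open>L\<^sub>p\<close> norm of \<open>h\<close> and the monotonicity of \<open>\<phi>(t) t\<^bsup>-d/p\<^esup>\<close>.\<close>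

lemma morrey_norm_dilate_le:
  fixes h :: "real^'n::finite \<Rightarrow> complex"
  assumes "0 < p" and phi: "\<phi> \<in> class_G CARD('n) p"
    and [measurable]: "h \<in> borel_measurable borel"
    and B: "\<And>x. norm (h x) \<le> B"
    and I: "(\<integral>\<^sup>+ x. ennreal (norm (h x) powr p) \<partial>lborel) = ennreal I" "0 \<le> I"
    and "0 < R" "0 \<le> A"
  shows "morrey_norm \<phi> p (\<lambda>x. complex_of_real A * h (R *\<^sub>R x)) \<le>
    ennreal (max B (I powr (1 / p)) * (A * \<phi> (1 / R)))"
  unfolding morrey_norm_def
proof (intro SUP_least, safe)
  fix j :: int and k :: "int^'n"
  let ?f = "\<lambda>x. complex_of_real A * h (R *\<^sub>R x)"
  let ?Q = "dyadic_cube j k :: (real^'n) set"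
  define l where "l = (2 powi (- j) :: real)"
  have l: "0 < l"
    by (simp add: l_def)
  let ?M = "ennreal (l ^ CARD('n))"
  define J where "J = (\<integral>\<^sup>+ y\<in>?Q. ennreal (norm (?f y) powr p) \<partial>lborel)"
  have M: "emeasure lborel ?Q = ?M"
    unfolding l_def by (rule emeasure_dyadic_cube)
  have B0: "0 \<le> B"
    using order_trans[OF norm_ge_zero B[of 0]] .
  have phil: "0 < \<phi> l" "0 < \<phi> (1 / R)"
    using phi l \<open>0 < R\<close> by (auto intro: class_G_pos)
  have "ennreal (\<phi> l) * ennpowr (J / ?M) (1 / p) \<le> ennreal (max B (I powr (1 / p)) * (A * \<phi> (1 / R)))"
  proof (cases "l \<le> 1 / R")
    \<comment> \<open>Small cube: replacing the integrand by its supremum makes the volume cancel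
      from the average.\<close>
    case True
    have "J \<le> (\<integral>\<^sup>+ y. ennreal ((A * B) powr p) * indicator ?Q y \<partial>lborel)"
      unfolding J_def using B B0 \<open>0 \<le> A\<close> \<open>0 < p\<close>
      by (intro nn_integral_mono mult_right_mono ennreal_leI powr_mono2) (auto simp: norm_mult mult_left_mono)
    also have "\<dots> = ennreal ((A * B) powr p) * ?M"
      using M by (simp add: nn_integral_cmult_indicator)
    finally have "J / ?M \<le> ennreal ((A * B) powr p) * ?M / ?M"
      by (rule divide_right_mono_ennreal)
    also have "\<dots> = ennreal ((A * B) powr p)"
      using l by (intro ennreal_mult_divide_eq) auto
    finally have "ennpowr (J / ?M) (1 / p) \<le> ennpowr (ennreal ((A * B) powr p)) (1 / p)"
      using \<open>0 < p\<close> by (intro ennpowr_mono) auto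
    also have "\<dots> = ennreal (A * B)"
      using B0 \<open>0 \<le> A\<close> \<open>0 < p\<close> by (simp add: ennpowr_ennreal powr_powr)
    finally have "ennreal (\<phi> l) * ennpowr (J / ?M) (1 / p) \<le> ennreal (\<phi> (1 / R)) * ennreal (A * B)"
      using True l phi by (intro mult_mono ennreal_leI class_G_mono[OF phi]) auto
    also have "\<dots> = ennreal (B * (A * \<phi> (1 / R)))"
      using phil B0 \<open>0 \<le> A\<close> by (simp add: mult_ac flip: ennreal_mult)
    also have "\<dots> \<le> ennreal (max B (I powr (1 / p)) * (A * \<phi> (1 / R)))"
      using phil \<open>0 \<le> A\<close> by (intro ennreal_leI mult_right_mono) auto
    finally show ?thesis .
  next
    case False
    let ?K = "\<integral>\<^sup>+ y. ennreal (norm (h (R *\<^sub>R y)) powr p) \<partial>lborel"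
    \<comment> \<open>Large cube: substituting \<open>R *\<^sub>R y\<close> divides the integral
      over the whole space by \<open>R^d\<close>. The average over the cube is then at most
      \<open>A^p * I * (R * l)^-d\<close>.\<close>
    have "ennreal I = ennreal (R ^ CARD('n)) * ?K"
      using \<open>0 < R\<close> nn_integral_lborel_scale[of "\<lambda>x. ennreal (norm (h x) powr p)" R] by (simp add: I)
    moreover have "?K * ennreal (R ^ CARD('n)) / ennreal (R ^ CARD('n)) = ?K"
      using \<open>0 < R\<close> by (intro ennreal_mult_divide_eq) auto
    ultimately have K: "?K = ennreal (I / R ^ CARD('n))"
      using \<open>0 < R\<close> \<open>0 \<le> I\<close> by (simp add: mult.commute flip: divide_ennreal)
    have "J \<le> (\<integral>\<^sup>+ y. ennreal (A powr p) * ennreal (norm (h (R *\<^sub>R y)) powr p) \<partial>lborel)"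
      unfolding J_def using \<open>0 \<le> A\<close>
      by (intro nn_integral_mono) (auto simp: norm_mult powr_mult indicator_def simp flip: ennreal_mult)
    also have "\<dots> = ennreal (A powr p) * ?K"
      by (rule nn_integral_cmult) measurable
    also have "\<dots> = ennreal (A powr p * (I / R ^ CARD('n)))"
      using \<open>0 \<le> I\<close> \<open>0 < R\<close> by (simp add: K flip: ennreal_mult)
    finally have "J / ?M \<le> ennreal (A powr p * (I / R ^ CARD('n))) / ?M"
      by (rule divide_right_mono_ennreal)
    also have "\<dots> = ennreal (A powr p * (I / R ^ CARD('n)) / l ^ CARD('n))"
      using l \<open>0 \<le> I\<close> \<open>0 < R\<close> by (intro divide_ennreal) auto
    also have "A powr p * (I / R ^ CARD('n)) / l ^ CARD('n) = A powr p * (I * (R * l) powr (- real CARD('n)))"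
      using l \<open>0 < R\<close> by (simp add: powr_minus powr_realpow power_mult_distrib divide_simps)
    finally have "ennpowr (J / ?M) (1 / p) \<le> ennpowr (ennreal (A powr p * (I * (R * l) powr (- real CARD('n))))) (1 / p)"
      using \<open>0 < p\<close> by (intro ennpowr_mono) auto
    also have "\<dots> = ennreal (A * (I powr (1 / p) * (R * l) powr (- real CARD('n) / p)))"
      using \<open>0 \<le> I\<close> \<open>0 \<le> A\<close> \<open>0 < p\<close> by (simp add: ennpowr_ennreal powr_mult powr_powr)
    finally have "ennreal (\<phi> l) * ennpowr (J / ?M) (1 / p) \<le>
        ennreal (\<phi> l) * ennreal (A * (I powr (1 / p) * (R * l) powr (- real CARD('n) / p)))"
      by (intro mult_left_mono) auto
    also have "\<dots> = ennreal (I powr (1 / p) * (A * (\<phi> l * (R * l) powr (- real CARD('n) / p))))"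
      using phil \<open>0 \<le> A\<close> by (simp add: mult_ac flip: ennreal_mult)
    also have "\<dots> \<le> ennreal (max B (I powr (1 / p)) * (A * \<phi> (1 / R)))"
    proof (intro ennreal_leI mult_mono)
      \<comment> \<open>Here \<open>1 / R < l\<close>, so comparing
        \<open>\<phi>(t) t^(-d/p)\<close> at these two points leaves opposite powers of
        \<open>R\<close>, which cancel.\<close>
      have "\<phi> l * (R * l) powr (- real CARD('n) / p) =
          (\<phi> l * l powr (- real CARD('n) / p)) * R powr (- real CARD('n) / p)"
        using l \<open>0 < R\<close> by (simp add: powr_mult)
      also have "\<dots> \<le> (\<phi> (1 / R) * (1 / R) powr (- real CARD('n) / p)) * R powr (- real CARD('n) / p)"
        using False \<open>0 < R\<close> by (intro mult_right_mono class_G_scale_le[OF phi]) auto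
      also have "\<dots> = \<phi> (1 / R)"
        using \<open>0 < R\<close> by (simp add: powr_divide)
      finally show "\<phi> l * (R * l) powr (- real CARD('n) / p) \<le> \<phi> (1 / R)" .
    qed (use phil \<open>0 \<le> A\<close> B0 in auto)
    finally show ?thesis .
  qed
  then show "ennreal (\<phi> (2 powi (- j))) * ennpowr ((\<integral>\<^sup>+ y\<in>?Q. ennreal (norm (?f y) powr p) \<partial>lebesgue)
      / emeasure lebesgue ?Q) (1 / p) \<le> ennreal (max B (I powr (1 / p)) * (A * \<phi> (1 / R)))"
    by (simp add: nn_integral_completion M J_def l_def del: power_int_minus)
qed

text \<open>One cube is tested, with a corner at the origin and side \<open>2^-(j+m)\<close>. The
  number \<open>m\<close> depends on \<open>h\<close> and the dimension but not on \<open>j\<close>,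
  so passing from side \<open>2^-j\<close> to this one costs the fixed factor
  \<open>2^(-m d/p)\<close> contained in \<open>c\<close>.\<close>

lemma morrey_norm_dilate_ge:
  fixes h :: "real^'n::finite \<Rightarrow> complex"
  assumes "0 < p" and phi: "\<phi> \<in> class_G CARD('n) p"
    and cont: "continuous_on UNIV h" and h0: "h 0 \<noteq> 0"
  obtains c where "0 < c" "\<And>A j. 0 \<le> A \<Longrightarrow>
    ennreal (c * (A * \<phi> (1 / 2 ^ j))) \<le> morrey_norm \<phi> p (\<lambda>x. complex_of_real A * h (2 ^ j *\<^sub>R x))"
proof -
  define b where "b = norm (h 0) / 2"
  have b: "0 < b"
    using h0 by (simp add: b_def)
  have "isCont h 0"
    using cont by (simp add: continuous_on_eq_continuous_at)
  then obtain r where r: "0 < r" "\<And>x. dist x 0 < r \<Longrightarrow> dist (h x) (h 0) < b"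
    using b unfolding continuous_at_eps_delta by metis
  have hb: "b \<le> norm (h x)" if "norm x < r" for x
    using r(2)[of x] that norm_triangle_ineq2[of "h 0" "h x"]
    by (simp add: b_def dist_norm norm_minus_commute)
  \<comment> \<open>After dilation by \<open>2 ^ j\<close> the test cube has side
    \<open>2^-m\<close>, and the norm of its points is at most the sum of their coordinates. This
    choice keeps it inside the ball where \<open>norm (h x) \<ge> b\<close>.\<close>
  obtain m :: nat where "(1 / 2) ^ m < r / real CARD('n)"
    using real_arch_pow_inv[of "r / real CARD('n)" "1 / 2"] r by auto
  then have m: "real CARD('n) * (1 / 2 ^ m) < r"
    by (simp add: power_one_over field_simps)
  define c where "c = b * (1 / 2 ^ m) powr (real CARD('n) / p)"
  show thesis
  proof
    show "0 < c"
      using b by (simp add: c_def)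
    fix A :: real and j :: nat
    assume A: "0 \<le> A"
    let ?f = "\<lambda>x. complex_of_real A * h (2 ^ j *\<^sub>R x)"
    let ?Q = "dyadic_cube (int (j + m)) 0 :: (real^'n) set"
    define l :: real where "l = 1 / 2 ^ (j + m)"
    have l: "0 < l" "2 powi (- int (j + m)) = l" "2 ^ j * l = 1 / 2 ^ m"
      by (auto simp: l_def power_int_minus power_add field_simps simp flip: of_nat_add)
    let ?M = "ennreal (l ^ CARD('n))"
    have M: "emeasure lborel ?Q = ?M"
      unfolding l(2)[symmetric] by (rule emeasure_dyadic_cube)
    have le: "(A * b) powr p \<le> norm (?f y) powr p" if "y \<in> ?Q" for y
    proof -
      have "0 \<le> y $ i \<and> y $ i < l" for i
        using that unfolding dyadic_cube_eq l(2) by simp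
      then have "norm (2 ^ j *\<^sub>R y) \<le> (\<Sum>i\<in>(UNIV :: 'n set). 2 ^ j * l)"
        by (intro order_trans[OF norm_le_l1_cart] sum_mono) (auto simp: abs_mult less_imp_le)
      also have "\<dots> < r"
        using m by (simp add: l(3))
      finally have "b \<le> norm (h (2 ^ j *\<^sub>R y))"
        by (rule hb)
      then show ?thesis
        using A b \<open>0 < p\<close> by (intro powr_mono2) (auto simp: norm_mult mult_left_mono)
    qed
    define J where "J = (\<integral>\<^sup>+ y\<in>?Q. ennreal (norm (?f y) powr p) \<partial>lborel)"
    have "ennreal ((A * b) powr p) * ?M = (\<integral>\<^sup>+ y. ennreal ((A * b) powr p) * indicator ?Q y \<partial>lborel)"
      using M by (simp add: nn_integral_cmult_indicator)
    also have "\<dots> \<le> J"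
      unfolding J_def using le by (intro nn_integral_mono) (auto simp: indicator_def ennreal_leI)
    finally have "ennreal ((A * b) powr p) * ?M / ?M \<le> J / ?M"
      by (rule divide_right_mono_ennreal)
    moreover have "ennreal ((A * b) powr p) * ?M / ?M = ennreal ((A * b) powr p)"
      using l by (intro ennreal_mult_divide_eq) auto
    ultimately have "ennpowr (ennreal ((A * b) powr p)) (1 / p) \<le> ennpowr (J / ?M) (1 / p)"
      using \<open>0 < p\<close> by (intro ennpowr_mono) auto
    then have J: "ennreal (A * b) \<le> ennpowr (J / ?M) (1 / p)"
      using A b \<open>0 < p\<close> by (simp add: ennpowr_ennreal powr_powr)
    \<comment> \<open>Monotonicity of \<open>\<phi>\<close> alone would bound
      \<open>\<phi> l\<close> from above. The bound from below comes from the nonincreasing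
      quotient, which limits the loss to \<open>2^(-m d/p)\<close>.\<close>
    have "\<phi> (1 / 2 ^ j) * (1 / 2 ^ j) powr (- real CARD('n) / p) \<le> \<phi> l * l powr (- real CARD('n) / p)"
      using l(1) by (intro class_G_scale_le[OF phi]) (auto simp: l_def power_add field_simps)
    also have "l powr (- real CARD('n) / p) = (1 / 2 ^ j) powr (- real CARD('n) / p) * (1 / 2 ^ m) powr (- real CARD('n) / p)"
      by (simp add: l_def power_add flip: powr_mult)
    finally have "(1 / 2 ^ j) powr (- real CARD('n) / p) * \<phi> (1 / 2 ^ j) \<le>
        (1 / 2 ^ j) powr (- real CARD('n) / p) * (\<phi> l * (1 / 2 ^ m) powr (- real CARD('n) / p))"
      by (simp add: mult_ac)
    then have "\<phi> (1 / 2 ^ j) \<le> \<phi> l * (1 / 2 ^ m) powr (- real CARD('n) / p)"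
      by (rule mult_left_le_imp_le) simp
    then have "\<phi> (1 / 2 ^ j) * (1 / 2 ^ m) powr (real CARD('n) / p) \<le>
        \<phi> l * ((1 / 2 ^ m) powr (- real CARD('n) / p) * (1 / 2 ^ m) powr (real CARD('n) / p))"
      by (metis mult_right_mono powr_ge_zero mult.assoc)
    then have "\<phi> (1 / 2 ^ j) * (1 / 2 ^ m) powr (real CARD('n) / p) \<le> \<phi> l"
      by (simp flip: powr_add)
    then have "(A * b) * (\<phi> (1 / 2 ^ j) * (1 / 2 ^ m) powr (real CARD('n) / p)) \<le> (A * b) * \<phi> l"
      using A b by (intro mult_left_mono) auto
    then have "c * (A * \<phi> (1 / 2 ^ j)) \<le> \<phi> l * (A * b)"
      by (simp only: c_def mult_ac)
    then have "ennreal (c * (A * \<phi> (1 / 2 ^ j))) \<le> ennreal (\<phi> l) * ennreal (A * b)"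
      using A b class_G_pos[OF phi l(1)] by (simp add: ennreal_leI flip: ennreal_mult)
    also have "\<dots> \<le> ennreal (\<phi> l) * ennpowr (J / ?M) (1 / p)"
      by (intro mult_left_mono J) auto
    also have "\<dots> = ennreal (\<phi> (2 powi (- int (j + m)))) * ennpowr ((\<integral>\<^sup>+ y\<in>?Q. ennreal (norm (?f y) powr p) \<partial>lebesgue)
      / emeasure lebesgue ?Q) (1 / p)"
      unfolding l(2) nn_integral_completion J_def M[symmetric] by simp
    also have "\<dots> \<le> morrey_norm \<phi> p ?f"
      unfolding morrey_norm_def by (intro SUP_upper2[of "(int (j + m), 0)"]) auto
    finally show "ennreal (c * (A * \<phi> (1 / 2 ^ j))) \<le> morrey_norm \<phi> p ?f" .
  qed
qed

section \<open>Littlewood--Paley pieces of the Dirac distribution\<close>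

lemma continuous_in_Lp_loc:
  fixes f :: "real^'n::finite \<Rightarrow> complex"
  assumes cont: "continuous_on UNIV f" and "0 < p"
  shows "f \<in> Lp_loc p"
proof -
  have [measurable]: "f \<in> borel_measurable borel"
    using cont by (rule borel_measurable_continuous_onI)
  have "(\<integral>\<^sup>+ y\<in>K. ennreal (norm (f y) powr p) \<partial>lebesgue) < \<infinity>" if K: "compact K" for K
  proof -
    have "bounded (f ` K)"
      using K cont by (intro compact_imp_bounded compact_continuous_image) (auto intro: continuous_on_subset)
    then obtain B where B: "\<And>x. x \<in> K \<Longrightarrow> norm (f x) \<le> B"
      by (auto simp: bounded_iff)
    have [measurable]: "K \<in> sets borel"
      using K by (simp add: borel_compact)
    have "(\<integral>\<^sup>+ y\<in>K. ennreal (norm (f y) powr p) \<partial>lebesgue) \<le>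
        (\<integral>\<^sup>+ y. ennreal (B powr p) * indicator K y \<partial>lborel)"
      unfolding nn_integral_completion using B \<open>0 < p\<close>
      by (intro nn_integral_mono) (auto simp: indicator_def intro!: ennreal_leI powr_mono2)
    also have "\<dots> = ennreal (B powr p) * emeasure lborel K"
      by (simp add: nn_integral_cmult_indicator)
    also have "\<dots> < \<infinity>"
      using emeasure_bounded_finite[OF compact_imp_bounded[OF K]] by (simp add: ennreal_mult_less_top)
    finally show ?thesis .
  qed
  then show ?thesis
    by (simp add: Lp_loc_def measurable_completion)
qed

text \<open>Evaluating the definite description takes uniqueness as well as a representing function;
  \<open>b\<close> is the bump with which uniqueness is proved.\<close>

lemma dist_function_eqI:
  fixes b :: "real^'n::finite \<Rightarrow> real"
  assumes "b \<in> schwartz" "\<And>x. 0 \<le> b x" "0 < b 0" "bounded {x. b x \<noteq> 0}"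
    and "represents g (T :: 'n functional)"
  shows "dist_function T = g"
  unfolding dist_function_def using assms represents_unique[OF assms(1-4)]
  by (intro the_equality) auto

text \<open>One factor \<open>(2\<pi>)\<^bsup>-d/2\<^esup>\<close> is the Fourier transform of the Dirac distribution; the other one is
  contained in the inverse transform.\<close>

definition band_kernel :: "(real^'n::finite \<Rightarrow> real) \<Rightarrow> real^'n \<Rightarrow> complex"
  where "band_kernel \<zeta> x =
    complex_of_real ((2 * pi) powr (- real CARD('n) / 2)) * inv_fourier (\<lambda>\<xi>. complex_of_real (\<zeta> \<xi>)) x"

text \<open>\<open>dirac\<close> evaluates the Fourier integral at 0, where the kernel equals 1. The
  functional is thus a constant times the pairing of \<open>\<zeta>\<close> with the inverse
  transform of the test function, and the Fubini identity applies.\<close>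

lemma represents_band_kernel:
  fixes \<zeta> :: "real^'n::finite \<Rightarrow> real"
  assumes zeta: "\<zeta> \<in> schwartz"
  shows "represents (band_kernel \<zeta>) (inv_fourier_dist (mult_dist \<zeta> (fourier_dist dirac)))"
proof -
  define c where "c = complex_of_real ((2 * pi) powr (- real CARD('n) / 2))"
  let ?f = "\<lambda>\<xi>. complex_of_real (\<zeta> \<xi>)"
  have f: "?f \<in> schwartz"
    by (intro schwartz_of_real zeta)
  have eq: "inv_fourier_dist (mult_dist \<zeta> (fourier_dist dirac)) \<psi> =
      c * (LINT \<xi>|lborel. ?f \<xi> * inv_fourier \<psi> \<xi>)" if "\<psi> \<in> schwartz" for \<psi>
  proof -
    have "(\<lambda>\<xi>. ?f \<xi> * inv_fourier \<psi> \<xi>) \<in> borel_measurable lborel"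
      using schwartz_borel_measurable[OF f]
        borel_measurable_continuous_onI[OF continuous_on_inv_fourier[OF integrable_schwartz[OF that]]]
      by simp
    then show ?thesis
      by (simp add: inv_fourier_dist_def mult_dist_def fourier_dist_def dirac_def fourier_def
          integral_completion c_def)
  qed
  have "band_kernel \<zeta> = (\<lambda>x. c * inv_fourier ?f x)"
    by (simp add: fun_eq_iff band_kernel_def c_def)
  then show ?thesis
    using represents_inv_fourier[OF f] unfolding represents_lborel
    by (auto simp: eq mult.assoc intro!: continuous_intros)
qed

lemma band_kernel_dilate:
  fixes \<zeta> :: "real^'n::finite \<Rightarrow> real"
  assumes "\<zeta> \<in> schwartz" "0 < c"
  shows "band_kernel (\<lambda>\<xi>. \<zeta> ((1 / c) *\<^sub>R \<xi>)) x = complex_of_real (c ^ CARD('n)) * band_kernel \<zeta> (c *\<^sub>R x)"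
  using inv_fourier_dilate[OF schwartz_borel_measurable[OF schwartz_of_real[OF assms(1)]] assms(2), of x]
  by (simp add: band_kernel_def)

lemma continuous_on_band_kernel:
  fixes \<zeta> :: "real^'n::finite \<Rightarrow> real"
  assumes "\<zeta> \<in> schwartz"
  shows "continuous_on UNIV (band_kernel \<zeta>)"
  using represents_band_kernel[OF assms] by (simp add: represents_def)

text \<open>At 0 the kernel is 1, so the value is a positive multiple of the integral of
  \<open>\<zeta>\<close>; nonnegativity excludes cancellation.\<close>

lemma band_kernel_zero_neq_zero:
  fixes \<zeta> :: "real^'n::finite \<Rightarrow> real"
  assumes zeta: "\<zeta> \<in> schwartz" and "\<And>x. 0 \<le> \<zeta> x" "0 < \<zeta> a"
  shows "band_kernel \<zeta> 0 \<noteq> 0"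
proof -
  have "0 < (LINT x|lborel. \<zeta> x)"
    using assms by (intro integral_continuous_pos[of _ a] schwartz_continuous integrable_schwartz) auto
  then show ?thesis
    using schwartz_borel_measurable[OF schwartz_of_real[OF zeta]]
    by (simp add: band_kernel_def inv_fourier_lborel)
qed

lemma band_kernel_decay:
  fixes \<zeta> :: "real^'n::finite \<Rightarrow> real"
  assumes "\<zeta> \<in> schwartz"
  shows "\<exists>C>0. \<forall>x. norm (band_kernel \<zeta> x) \<le> C / (1 + norm x) ^ N"
proof -
  let ?c = "(2 * pi) powr (- real CARD('n) / 2)"
  obtain C where C: "0 < C" "\<And>x. norm (inv_fourier (\<lambda>\<xi>. complex_of_real (\<zeta> \<xi>)) x) \<le> C / (1 + norm x) ^ N"
    using inv_fourier_decay[OF schwartz_of_real[OF assms]] by metis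
  have "norm (band_kernel \<zeta> x) \<le> ?c * C / (1 + norm x) ^ N" for x
    using mult_left_mono[OF C(2), of ?c x] by (simp add: band_kernel_def norm_mult)
  moreover have "0 < ?c * C"
    using C by simp
  ultimately show ?thesis
    by blast
qed

text \<open>The constants are fixed before \<open>A\<close> and \<open>j\<close>. This uniformity
  lets one pair of constants serve all dilates of a profile, with \<open>A\<close> becoming
  \<open>2^(j d)\<close>.\<close>

lemma morrey_norm_band_kernel_bounds:
  fixes \<zeta> :: "real^'n::finite \<Rightarrow> real"
  assumes zeta: "\<zeta> \<in> schwartz" "\<And>x. 0 \<le> \<zeta> x" "0 < \<zeta> a"
    and "0 < p" and phi: "\<phi> \<in> class_G CARD('n) p"
  obtains c C where "0 < c" "0 < C"
    "\<And>A j. 0 \<le> A \<Longrightarrow> ennreal (c * (A * \<phi> (1 / 2 ^ j))) \<le>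
      morrey_norm \<phi> p (\<lambda>x. complex_of_real A * band_kernel \<zeta> (2 ^ j *\<^sub>R x))"
    "\<And>A j. 0 \<le> A \<Longrightarrow> morrey_norm \<phi> p (\<lambda>x. complex_of_real A * band_kernel \<zeta> (2 ^ j *\<^sub>R x)) \<le>
      ennreal (C * (A * \<phi> (1 / 2 ^ j)))"
proof -
  note cont = continuous_on_band_kernel[OF zeta(1)]
  obtain c where c: "0 < c" "\<And>A j. 0 \<le> A \<Longrightarrow> ennreal (c * (A * \<phi> (1 / 2 ^ j))) \<le>
      morrey_norm \<phi> p (\<lambda>x. complex_of_real A * band_kernel \<zeta> (2 ^ j *\<^sub>R x))"
    using morrey_norm_dilate_ge[OF \<open>0 < p\<close> phi cont band_kernel_zero_neq_zero[OF zeta]] by blast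
  obtain B where B: "0 < B" "\<And>x. norm (band_kernel \<zeta> x) \<le> B"
    using band_kernel_decay[OF zeta(1), of 0] by auto
  let ?J = "\<integral>\<^sup>+ x. ennreal (norm (band_kernel \<zeta> x) powr p) \<partial>lborel"
  have J: "?J = ennreal (enn2real ?J)"
    using nn_integral_norm_powr_finite[OF \<open>0 < p\<close> band_kernel_decay[OF zeta(1)]] by (simp add: less_top)
  show thesis
  proof (rule that[OF c(1) _ c(2)])
    show "morrey_norm \<phi> p (\<lambda>x. complex_of_real A * band_kernel \<zeta> (2 ^ j *\<^sub>R x)) \<le>
        ennreal (max B (enn2real ?J powr (1 / p)) * (A * \<phi> (1 / 2 ^ j)))" if "0 \<le> A" for A j
      using borel_measurable_continuous_onI[OF cont] B(2) J that
      by (intro morrey_norm_dilate_le \<open>0 < p\<close> phi) auto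
    show "0 < max B (enn2real ?J powr (1 / p))"
      using B by simp
  qed auto
qed

text \<open>\<open>cube r\<close> has half side \<open>r / 2\<close>, so the all-ones vector is a
  corner of \<open>cube 2\<close> and lies outside \<open>cube 1\<close>.\<close>

lemma admissible_positive_point:
  fixes \<eta>\<^sub>0 \<eta> :: "real^'n::finite \<Rightarrow> real"
  assumes "admissible \<eta>\<^sub>0 \<eta>"
  shows "0 < \<eta>\<^sub>0 0" "0 < \<eta> (\<chi> i. 1)"
proof -
  have "(0 :: real^'n) \<in> cube 2" "(\<chi> i. 1 :: real^'n) \<in> cube 2 - cube 1"
    by (auto simp: cube_def mem_box_cart)
  then show "0 < \<eta>\<^sub>0 0" "0 < \<eta> (\<chi> i. 1)"
    using assms unfolding admissible_def by blast+
qed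

lemma lp_piece_dirac:
  fixes \<eta>\<^sub>0 \<eta> :: "real^'n::finite \<Rightarrow> real"
  assumes adm: "admissible \<eta>\<^sub>0 \<eta>"
  shows "lp_piece \<eta>\<^sub>0 \<eta> j dirac =
    (\<lambda>x. complex_of_real ((2 ^ j) ^ CARD('n)) * band_kernel (if j = 0 then \<eta>\<^sub>0 else \<eta>) (2 ^ j *\<^sub>R x))"
proof -
  let ?\<zeta> = "if j = 0 then \<eta>\<^sub>0 else \<eta>"
  have zeta: "?\<zeta> \<in> schwartz"
    using adm by (simp add: admissible_def)
  have dil: "dyadic_dilate \<eta>\<^sub>0 \<eta> j = (\<lambda>\<xi>. ?\<zeta> ((1 / 2 ^ j) *\<^sub>R \<xi>))"
    by (auto simp: dyadic_dilate_def)
  have "dyadic_dilate \<eta>\<^sub>0 \<eta> j \<in> schwartz"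
    using schwartz_affine[OF zeta, of "1 / 2 ^ j" 0] unfolding dil by simp
  then have rep: "represents (band_kernel (dyadic_dilate \<eta>\<^sub>0 \<eta> j))
      (inv_fourier_dist (mult_dist (dyadic_dilate \<eta>\<^sub>0 \<eta> j) (fourier_dist dirac)))"
    by (rule represents_band_kernel)
  \<comment> \<open>\<open>\<eta>\<^sub>0\<close> is the bump for uniqueness at every level
    \<open>j\<close>. The profile \<open>\<eta>\<close> cannot take this role, since it vanishes at
    0.\<close>
  have "bounded {x. \<eta>\<^sub>0 x \<noteq> 0}"
    using adm unfolding admissible_def supp_def
    by (meson bounded_subset closure_subset compact_imp_bounded)
  then have "lp_piece \<eta>\<^sub>0 \<eta> j dirac = band_kernel (dyadic_dilate \<eta>\<^sub>0 \<eta> j)"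
    unfolding lp_piece_def using adm admissible_positive_point(1)[OF adm] by (intro dist_function_eqI[of \<eta>\<^sub>0] rep) (auto simp: admissible_def)
  then show ?thesis
    unfolding dil using band_kernel_dilate[OF zeta, of "2 ^ j"] by auto
qed

section \<open>Two-sided comparison of the weighted Morrey norms with the given sequence\<close>

theorem lemma3p7:
  fixes \<eta>\<^sub>0 \<eta> :: "real^'n::finite \<Rightarrow> real"
    and s p :: real and q :: ennreal and \<phi> :: "real \<Rightarrow> real"
  assumes "0 < p" and "0 < q"
    and "\<phi> \<in> class_G CARD('n) p"
    and "admissible \<eta>\<^sub>0 \<eta>"
  shows "(dirac :: 'n functional) \<in> besov_morrey \<eta>\<^sub>0 \<eta> s \<phi> p q \<longleftrightarrow>
    (\<lambda>j::nat. 2 powr (real j * (s + real CARD('n))) * \<phi> (2 powr (- real j))) \<in> ell q"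
proof -
  note phi = assms(3) and adm = assms(4)
  let ?\<zeta> = "\<lambda>j::nat. if j = 0 then \<eta>\<^sub>0 else \<eta>"
  let ?F = "\<lambda>j. lp_piece \<eta>\<^sub>0 \<eta> j dirac"
  define A :: "nat \<Rightarrow> real" where "A j = (2 ^ j) ^ CARD('n)" for j
  define a where "a j = 2 powr (real j * (s + real CARD('n))) * \<phi> (2 powr (- real j))" for j :: nat
  define b where "b j = ennreal (2 powr (real j * s)) * morrey_norm \<phi> p (?F j)" for j
  have A: "0 \<le> A j" for j
    by (simp add: A_def)
  have phi_pos: "0 < \<phi> (1 / 2 ^ j)" for j :: nat
    by (intro class_G_pos[OF phi]) simp
  \<comment> \<open>Splits \<open>2^(j(s+d))\<close> into the smoothness weight
    \<open>2^(js)\<close> and the amplitude \<open>A j = 2^(jd)\<close> of the piece.\<close>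
  have a: "a j = 2 powr (real j * s) * (A j * \<phi> (1 / 2 ^ j))" for j
  proof -
    have "2 powr (real j * real CARD('n)) = (2 ^ j) ^ CARD('n)"
      by (simp add: powr_realpow flip: power_mult of_nat_mult)
    moreover have "2 powr (- real j) = 1 / 2 ^ j"
      by (simp add: powr_minus powr_realpow divide_inverse)
    ultimately show ?thesis
      by (simp add: a_def A_def distrib_left powr_add)
  qed
  have a_pos: "0 \<le> a j" for j
    unfolding a using A phi_pos[of j] by simp
  have F: "?F j = (\<lambda>x. complex_of_real (A j) * band_kernel (?\<zeta> j) (2 ^ j *\<^sub>R x))" for j
    unfolding A_def by (rule lp_piece_dirac[OF adm])
  have sch: "\<eta>\<^sub>0 \<in> schwartz" "\<eta> \<in> schwartz" and nonn: "\<And>x. 0 \<le> \<eta>\<^sub>0 x" "\<And>x. 0 \<le> \<eta> x"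
    using adm by (auto simp: admissible_def)
  \<comment> \<open>Level 0 uses the profile \<open>\<eta>\<^sub>0\<close> and all other levels use
    \<open>\<eta>\<close>. Taking the minimum of the lower and the maximum of the upper constants
    gives bounds valid for every \<open>j\<close>.\<close>
  obtain c0 C0 where 0: "0 < c0" "0 < C0"
    "\<And>A j. 0 \<le> A \<Longrightarrow> ennreal (c0 * (A * \<phi> (1 / 2 ^ j))) \<le>
      morrey_norm \<phi> p (\<lambda>x. complex_of_real A * band_kernel \<eta>\<^sub>0 (2 ^ j *\<^sub>R x))"
    "\<And>A j. 0 \<le> A \<Longrightarrow> morrey_norm \<phi> p (\<lambda>x. complex_of_real A * band_kernel \<eta>\<^sub>0 (2 ^ j *\<^sub>R x)) \<le>
      ennreal (C0 * (A * \<phi> (1 / 2 ^ j)))"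
    by (rule morrey_norm_band_kernel_bounds[OF sch(1) nonn(1)
          admissible_positive_point(1)[OF adm] \<open>0 < p\<close> phi]) (rule that)
  obtain c1 C1 where 1: "0 < c1" "0 < C1"
    "\<And>A j. 0 \<le> A \<Longrightarrow> ennreal (c1 * (A * \<phi> (1 / 2 ^ j))) \<le>
      morrey_norm \<phi> p (\<lambda>x. complex_of_real A * band_kernel \<eta> (2 ^ j *\<^sub>R x))"
    "\<And>A j. 0 \<le> A \<Longrightarrow> morrey_norm \<phi> p (\<lambda>x. complex_of_real A * band_kernel \<eta> (2 ^ j *\<^sub>R x)) \<le>
      ennreal (C1 * (A * \<phi> (1 / 2 ^ j)))"
    by (rule morrey_norm_band_kernel_bounds[OF sch(2) nonn(2)
          admissible_positive_point(2)[OF adm] \<open>0 < p\<close> phi]) (rule that)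
  define c where "c = min c0 c1"
  define C where "C = max C0 C1"
  have cC: "0 < c" "0 < C"
    using 0 1 by (auto simp: c_def C_def)
  have nonneg: "0 \<le> A j * \<phi> (1 / 2 ^ j)" for j
    using A phi_pos[of j] by simp
  have lower: "ennreal (c * (A j * \<phi> (1 / 2 ^ j))) \<le> morrey_norm \<phi> p (?F j)" for j
  proof -
    have "ennreal (c * (A j * \<phi> (1 / 2 ^ j))) \<le> ennreal ((if j = 0 then c0 else c1) * (A j * \<phi> (1 / 2 ^ j)))"
      using nonneg[of j] by (intro ennreal_leI mult_right_mono) (auto simp: c_def)
    also have "\<dots> \<le> morrey_norm \<phi> p (?F j)"
      unfolding F using 0(3)[OF A, of j j] 1(3)[OF A, of j j] by auto
    finally show ?thesis .
  qed
  have upper: "morrey_norm \<phi> p (?F j) \<le> ennreal (C * (A j * \<phi> (1 / 2 ^ j)))" for j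
  proof -
    have "morrey_norm \<phi> p (?F j) \<le> ennreal ((if j = 0 then C0 else C1) * (A j * \<phi> (1 / 2 ^ j)))"
      unfolding F using 0(4)[OF A, of j j] 1(4)[OF A, of j j] by auto
    also have "\<dots> \<le> ennreal (C * (A j * \<phi> (1 / 2 ^ j)))"
      using nonneg[of j] by (intro ennreal_leI mult_right_mono) (auto simp: C_def)
    finally show ?thesis .
  qed
  have ab: "ennreal (a j) \<le> ennreal (1 / c) * b j" for j
  proof -
    have "ennreal (a j) = ennreal (1 / c) * (ennreal (2 powr (real j * s)) * ennreal (c * (A j * \<phi> (1 / 2 ^ j))))"
      using cC nonneg[of j] by (simp add: a flip: ennreal_mult)
    also have "\<dots> \<le> ennreal (1 / c) * b j"
      unfolding b_def by (intro mult_left_mono lower) auto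
    finally show ?thesis .
  qed
  have ba: "b j \<le> ennreal C * ennreal (a j)" for j
  proof -
    have "b j \<le> ennreal (2 powr (real j * s)) * ennreal (C * (A j * \<phi> (1 / 2 ^ j)))"
      unfolding b_def by (intro mult_left_mono upper) auto
    also have "\<dots> = ennreal C * ennreal (a j)"
      unfolding a using cC nonneg[of j]
      by (simp only: ennreal_mult less_imp_le powr_ge_zero) (rule mult.left_commute)
    finally show ?thesis .
  qed
  have "lq_norm q b < \<infinity> \<longleftrightarrow> lq_norm q (\<lambda>j. ennreal \<bar>a j\<bar>) < \<infinity>"
  proof
    assume "lq_norm q b < \<infinity>"
    then have "lq_norm q (\<lambda>j. ennreal (a j)) < \<infinity>"
      by (rule lq_norm_finite_cmult_le[OF ab, rotated]) (use cC in auto)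
    then show "lq_norm q (\<lambda>j. ennreal \<bar>a j\<bar>) < \<infinity>"
      using a_pos by simp
  next
    assume "lq_norm q (\<lambda>j. ennreal \<bar>a j\<bar>) < \<infinity>"
    then have "lq_norm q (\<lambda>j. ennreal (a j)) < \<infinity>"
      using a_pos by simp
    then show "lq_norm q b < \<infinity>"
      by (rule lq_norm_finite_cmult_le[OF ba, rotated]) (use cC in auto)
  qed
  \<comment> \<open>Finiteness of the Besov-Morrey norm is only part of membership: each piece must
    also lie in the Morrey space. Continuity gives local integrability of the \<open>p\<close>-th
    power, and the upper bound gives a finite norm.\<close>
  moreover have "?F j \<in> morrey \<phi> p" for j
  proof -
    have "?\<zeta> j \<in> schwartz"
      using adm by (simp add: admissible_def)
    then have "continuous_on UNIV (?F j)"
      unfolding F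
      by (intro continuous_intros continuous_on_compose2[OF continuous_on_band_kernel]) auto
    then show ?thesis
      using upper[of j] \<open>0 < p\<close> by (auto simp: morrey_def continuous_in_Lp_loc intro: order.strict_trans1)
  qed
  ultimately show ?thesis
    unfolding besov_morrey_def besov_morrey_norm_def ell_def a_def b_def
    using dirac_tempered by blast
qed

end
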